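(* Let $X, X_1, X_2, \ldots$ be i.i.d. real random variables with common law $P$ on $\mathbb{R}$. Suppose the functions $F:\mathbb{R}\to[0,\infty)$ and $U:\mathbb{R}\to\mathbb{R}$ have finite first moments $\mu := E[F(X)]$, $\nu := E[U(X)]$, and also finite second moments $E[F(X)^2]$, $E[U(X)^2]$. Assume that $E[e^{\theta F(X)}]=\infty$ for all $\theta>0$, and that $m(\beta) := \operatorname{ess\,sup}[F(X)-\beta U(X)] < \infty$ for all $\beta>0$. Let $S_n := \sum_{i=1}^n F(X_i)$ and $T_n := \sum_{i=1}^n U(X_i)$. Then: (i) For all $\varepsilon>0$, $$\lim_{n\to\infty}\frac1n\log\Pr\{S_n-n\mu>n\varepsilon\} = -\inf_{Q\in\Sigma}H(Q\|P)=0,$$ where $\Sigma$ is the set of all probability measures $Q$ on $\mathbb{R}$ such that $\int F\,dQ-\mu>\varepsilon$. (ii) For all $\varepsilon,u>0$, $$\lim_{n\to\infty}\frac1n\log\Pr\{S_n-n\mu>n\varepsilon \text{ and } T_n-n\nu<nu\} = -\inf_{Q\in E}H(Q\|P)<0,$$ where $E\subset\Sigma$ is the set of all probability measures $Q$ on $\mathbb{R}$ such that $\int F\,dQ-\mu>\varepsilon$ and $\int U\,dQ-\nu<u$.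
   Context: Functions are Borel measurable. The relative entropy between probability measures $Q$ and $P$ on the same space is $H(Q\|P) := \int dQ\,\log\frac{dQ}{dP}$ when the density $\frac{dQ}{dP}$ exists, and $H(Q\|P):=\infty$ otherwise. The essential supremum is with respect to the law of $X$. Integral conditions defining $\Sigma$ and $E$ are understood to require that the integrals be well defined (in the extended reals). Conventions: $\log 0=-\infty$, and the infimum over the empty set is $+\infty$. *)

theory Defs
  imports "HOL-Probability.Probability"
begin

text \<open>
  Natural logarithm with values in the extended reals, so that the logarithm of
  \<open>0\<close> is \<open>-\<infinity>\<close> (the real function \<^const>\<open>ln\<close> has \<open>ln 0 = 0\<close>).
\<close>

definition ext_ln :: "ennreal \<Rightarrow> ereal" where
  "ext_ln x = (if x = 0 then -\<infinity> else if x = \<infinity> then \<infinity> else ereal (ln (enn2real x)))"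

text \<open>
  The integral of an extended real function, itself an extended real. The Bochner
  integral is \<open>0\<close> on non-integrable functions, hence cannot express that an integral
  is infinite. \<^const>\<open>e2ennreal\<close> truncates negative values to \<open>0\<close>, so the
  two terms below are the integrals of the positive and the negative part.
\<close>

definition ext_integral :: "'a measure \<Rightarrow> ('a \<Rightarrow> ereal) \<Rightarrow> ereal" where
  "ext_integral M f =
     enn2ereal (\<integral>\<^sup>+ x. e2ennreal (f x) \<partial>M) - enn2ereal (\<integral>\<^sup>+ x. e2ennreal (- f x) \<partial>M)"

definition ext_integral_exists :: "'a measure \<Rightarrow> ('a \<Rightarrow> ereal) \<Rightarrow> bool" where
  "ext_integral_exists M f \<longleftrightarrow> f \<in> borel_measurable M \<and>
     ((\<integral>\<^sup>+ x. e2ennreal (f x) \<partial>M) < \<infinity> \<or> (\<integral>\<^sup>+ x. e2ennreal (- f x) \<partial>M) < \<infinity>)"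

text \<open>
  Note the argument order \<open>RN_deriv P Q = dQ/dP\<close>. For probability measures the
  integral below always exists. The library's \<^const>\<open>KL_divergence\<close> is
  real-valued and \<open>0\<close> where the relative entropy is infinite.
\<close>

definition relative_entropy :: "'a measure \<Rightarrow> 'a measure \<Rightarrow> ereal" where
  "relative_entropy Q P =
     (if \<exists>f \<in> borel_measurable P. density P f = Q
      then ext_integral Q (\<lambda>x. ext_ln (RN_deriv P Q x)) else \<infinity>)"

definition Sigma_set :: "(real \<Rightarrow> real) \<Rightarrow> real \<Rightarrow> real \<Rightarrow> real measure set" where
  "Sigma_set F \<mu> \<epsilon> =
     {Q. prob_space Q \<and> sets Q = sets borel \<and>
         ext_integral_exists Q (\<lambda>x. ereal (F x)) \<and>
         ext_integral Q (\<lambda>x. ereal (F x)) - ereal \<mu> > ereal \<epsilon>}"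

definition E_set ::
    "(real \<Rightarrow> real) \<Rightarrow> real \<Rightarrow> real \<Rightarrow> (real \<Rightarrow> real) \<Rightarrow> real \<Rightarrow> real \<Rightarrow> real measure set" where
  "E_set F \<mu> \<epsilon> U \<nu> u =
     {Q \<in> Sigma_set F \<mu> \<epsilon>.
         ext_integral_exists Q (\<lambda>x. ereal (U x)) \<and>
         ext_integral Q (\<lambda>x. ereal (U x)) - ereal \<nu> < ereal u}"

end

theory Submission
  imports Defs
begin

text \<open>
  Upper bound: if the deviation event has probability \<open>p > 0\<close>, average over \<open>i \<le> n\<close> the laws of
  \<open>X i\<close> conditioned on it. The average \<open>Q\<close> satisfies the linear constraints defining the set
  of measures, and Jensen's inequality applied to \<open>\<Prod>i. (dQ/dP) (X i)\<close>, whose mean is \<open>1\<close>, gives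
  \<open>n H(Q|P) \<le> - ln p\<close>.
  Lower bound: change the law \<open>P\<close> into any admissible \<open>Q\<close>, truncated so that exponential Chebyshev
  bounds replace the weak law of large numbers.

  For (i), heavy tails allow mass of order \<open>1/k\<close> to be moved to \<open>{F \<ge> k}\<close> at arbitrarily small entropy
  cost. For (ii), \<open>F - \<beta> U\<close> is bounded above and square integrable, so its exponential moments have a
  quadratic expansion at \<open>0\<close>; for \<open>\<beta> u < \<epsilon>\<close> the constraints force its mean up, and the
  Donsker--Varadhan inequality then bounds the entropy away from \<open>0\<close>.
\<close>

text \<open>The means of \<open>F\<close> and \<open>U\<close> are linear in the law but not weakly
  continuous, and in (i) \<open>F\<close> has no positive exponential moment, so neither compactness
  nor a Chernoff bound for the sums of \<open>F\<close> is at hand. Everything is therefore done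
  with explicit densities: a law of finite entropy is written \<open>density P r\<close> with
  \<open>ln (r x)\<close> integrable under it. The upper bound holds for each single
  \<open>n\<close>; limits enter only in the lower bound. In (i) the rate is 0, so the upper bound
  is just that a probability is at most 1. In (ii) the mean of \<open>F\<close> under a competing
  law could a priori be infinite; the one-sided bound on \<open>F - U\<close> excludes this, because
  it dominates \<open>F\<close> by \<open>U\<close> plus a constant while the mean of
  \<open>U\<close> is bounded above.\<close>

section \<open>Extended integrals, and relative entropy through real densities\<close>

lemma ext_integral_eq_integral:
  fixes f :: "'a \<Rightarrow> real"
  assumes "integrable M f"
  shows "ext_integral M (\<lambda>x. ereal (f x)) = ereal (\<integral>x. f x \<partial>M)"
proof -
  have "(\<integral>\<^sup>+ x. ennreal (f x) \<partial>M) \<noteq> \<infinity>" "(\<integral>\<^sup>+ x. ennreal (- f x) \<partial>M) \<noteq> \<infinity>"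
    using assms by (auto simp: real_integrable_def)
  then show ?thesis
    unfolding ext_integral_def real_lebesgue_integral_def[OF assms]
    by (cases "\<integral>\<^sup>+ x. ennreal (f x) \<partial>M"; cases "\<integral>\<^sup>+ x. ennreal (- f x) \<partial>M") auto
qed

lemma ext_integral_exists_integrable:
  fixes f :: "'a \<Rightarrow> real"
  assumes "integrable M f"
  shows "ext_integral_exists M (\<lambda>x. ereal (f x))"
  using assms by (auto simp: ext_integral_exists_def real_integrable_def less_top[symmetric])

text \<open>With a finite negative part no \<open>\<infinity> - \<infinity>\<close> can occur, so an
  upper bound on the extended value controls the positive part.\<close>

lemma integrable_of_ext_integral_less_PInf:
  fixes f :: "'a \<Rightarrow> real"
  assumes "f \<in> borel_measurable M" "(\<integral>\<^sup>+ x. ennreal (- f x) \<partial>M) < \<infinity>"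
    and "ext_integral M (\<lambda>x. ereal (f x)) < \<infinity>"
  shows "integrable M f"
proof -
  have "(\<integral>\<^sup>+ x. ennreal (f x) \<partial>M) \<noteq> \<infinity>"
    using assms(2,3) unfolding ext_integral_def
    by (cases "\<integral>\<^sup>+ x. ennreal (f x) \<partial>M"; cases "\<integral>\<^sup>+ x. ennreal (- f x) \<partial>M") auto
  then show ?thesis
    using assms by (auto simp: real_integrable_def)
qed

text \<open>The points where \<open>r\<close> vanishes carry no mass under the tilted law, so the
  default value \<open>ln 0 = 0\<close> is invisible to integrals against it.\<close>

lemma AE_density_pos:
  fixes r :: "'a \<Rightarrow> real"
  assumes [measurable]: "r \<in> borel_measurable P"
  shows "AE x in density P r. 0 < r x"
  by (subst AE_density) auto

text \<open>Densities are unique up to \<open>P\<close>-null sets, and these are null under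
  \<open>density P r\<close> as well; hence any explicit density may stand in for
  \<open>RN_deriv\<close>.\<close>

lemma relative_entropy_density:
  fixes r :: "'a \<Rightarrow> real"
  assumes "sigma_finite_measure P" and [measurable]: "r \<in> borel_measurable P"
  shows "relative_entropy (density P r) P = ext_integral (density P r) (\<lambda>x. ereal (ln (r x)))"
proof -
  interpret sigma_finite_measure P by fact
  let ?Q = "density P r"
  have "AE x in P. ennreal (r x) = RN_deriv P ?Q x"
    by (rule RN_deriv_unique) auto
  then have "AE x in ?Q. ennreal (r x) = RN_deriv P ?Q x"
    by (subst AE_density) auto
  then have *: "AE x in ?Q. ext_ln (RN_deriv P ?Q x) = ereal (ln (r x))"
    using AE_density_pos[OF assms(2)]
  proof eventually_elim
    case (elim x)
    have "ext_ln (ennreal (r x)) = ereal (ln (r x))"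
      using elim(2) by (simp add: ext_ln_def)
    then show ?case using elim(1) by simp
  qed
  have "relative_entropy ?Q P = ext_integral ?Q (\<lambda>x. ext_ln (RN_deriv P ?Q x))"
    unfolding relative_entropy_def by (auto intro!: bexI[of _ "\<lambda>x. ennreal (r x)"])
  also have "\<dots> = ext_integral ?Q (\<lambda>x. ereal (ln (r x)))"
    unfolding ext_integral_def using *
    by (intro arg_cong2[where f="(-)"] arg_cong[where f=enn2ereal] nn_integral_cong_AE) auto
  finally show ?thesis .
qed

text \<open>Since \<open>- x * ln x\<close> is at most 1 for positive \<open>x\<close>, the negative
  part of the entropy integrand is always finite. Finiteness of the entropy is then the same as
  integrability of the log-density.\<close>

lemma nn_integral_neg_ln_density:
  fixes r :: "'a \<Rightarrow> real"
  assumes "prob_space P" and [measurable]: "r \<in> borel_measurable P"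
  shows "(\<integral>\<^sup>+ x. ennreal (- ln (r x)) \<partial>density P r) \<le> 1"
proof -
  interpret prob_space P by fact
  have *: "x * (- ln x) \<le> 1" if "0 < x" for x :: real
  proof -
    have "- ln x \<le> 1 / x"
      using that ln_le_minus_one[of "1/x"] by (simp add: ln_div)
    from mult_left_mono[OF this, of x] that show ?thesis by simp
  qed
  have "(\<integral>\<^sup>+ x. ennreal (- ln (r x)) \<partial>density P r) = (\<integral>\<^sup>+ x. ennreal (r x) * ennreal (- ln (r x)) \<partial>P)"
    by (subst nn_integral_density) auto
  also have "\<dots> \<le> (\<integral>\<^sup>+ x. 1 \<partial>P)"
  proof (intro nn_integral_mono)
    fix x show "ennreal (r x) * ennreal (- ln (r x)) \<le> 1"
    proof (cases "r x > 0")
      case True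
      then show ?thesis using *[OF True] by (simp flip: ennreal_mult')
    qed (simp add: ennreal_neg)
  qed
  also have "\<dots> = 1" by (simp add: emeasure_space_1)
  finally show ?thesis .
qed

lemma relative_entropy_density_integrable:
  fixes r :: "'a \<Rightarrow> real"
  assumes "sigma_finite_measure P" "r \<in> borel_measurable P" "integrable (density P r) (\<lambda>x. ln (r x))"
  shows "relative_entropy (density P r) P = ereal (\<integral>x. ln (r x) \<partial>density P r)"
  by (simp add: relative_entropy_density ext_integral_eq_integral assms)

text \<open>Leaves the extended reals once and for all: the density has integral 1, hence is finite
  almost everywhere and can be made real-valued.\<close>

lemma finite_relative_entropyE:
  assumes "prob_space P" "prob_space Q" "relative_entropy Q P < \<infinity>"
  obtains r :: "'a \<Rightarrow> real" where "r \<in> borel_measurable P" "\<And>x. 0 \<le> r x" "Q = density P r"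
    "integrable Q (\<lambda>x. ln (r x))" "relative_entropy Q P = ereal (\<integral>x. ln (r x) \<partial>Q)"
proof -
  interpret P: prob_space P by fact
  interpret Q: prob_space Q by fact
  obtain f where f[measurable]: "f \<in> borel_measurable P" and Qf: "density P f = Q"
    using assms(3) unfolding relative_entropy_def by (auto split: if_splits)
  define r where "r x = enn2real (f x)" for x
  have r[measurable]: "r \<in> borel_measurable P" unfolding r_def by measurable
  have "(\<integral>\<^sup>+ x. f x \<partial>P) = emeasure (density P f) (space P)"
    by (simp add: emeasure_density cong: nn_integral_cong)
  also have "\<dots> = 1" using Q.emeasure_space_1 unfolding Qf[symmetric] by simp
  finally have "AE x in P. f x \<noteq> \<infinity>"
    by (intro nn_integral_noteq_infinite) auto
  then have Q: "Q = density P r"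
    unfolding Qf[symmetric] by (intro density_cong) (auto simp: r_def less_top)
  have rE: "relative_entropy Q P = ext_integral Q (\<lambda>x. ereal (ln (r x)))"
    unfolding Q by (intro relative_entropy_density r) unfold_locales
  have "(\<integral>\<^sup>+ x. ennreal (- ln (r x)) \<partial>Q) < \<infinity>"
    using nn_integral_neg_ln_density[OF assms(1) r] unfolding Q
    by (metis ennreal_one_less_top infinity_ennreal_def order_le_less_trans)
  then have int: "integrable Q (\<lambda>x. ln (r x))"
    by (intro integrable_of_ext_integral_less_PInf) (use assms(3) rE in \<open>auto simp: Q\<close>)
  show thesis
    by (rule that[of r]) (use int Q rE in \<open>auto simp: r_def[abs_def] ext_integral_eq_integral\<close>)
qed

section \<open>Entropy bounds from exponential integrals\<close>

lemma integral_le_if_nn_integral_le: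
  fixes f :: "'a \<Rightarrow> real"
  assumes "integrable M f" "(\<integral>\<^sup>+ x. ennreal (f x) \<partial>M) \<le> ennreal c" "0 \<le> c"
  shows "(\<integral>x. f x \<partial>M) \<le> c"
proof -
  have "enn2real (\<integral>\<^sup>+ x. ennreal (f x) \<partial>M) \<le> c"
    using assms(2,3) by (simp add: enn2real_leI)
  then show ?thesis
    unfolding real_lebesgue_integral_def[OF assms(1)]
    by (smt (verit) enn2real_nonneg)
qed

text \<open>Jensen's inequality in the form used throughout, obtained by integrating
  \<open>1 + f x \<le> exp (f x)\<close>. The exponential stays inside a nonnegative integral, which
  may be estimated freely.\<close>

lemma (in prob_space) expectation_nonpos_if_exp:
  fixes f :: "'a \<Rightarrow> real"
  assumes "integrable M f" "(\<integral>\<^sup>+ x. ennreal (exp (f x)) \<partial>M) \<le> 1"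
  shows "expectation f \<le> 0"
proof -
  have "(\<integral>\<^sup>+ x. ennreal (1 + f x) \<partial>M) \<le> (\<integral>\<^sup>+ x. ennreal (exp (f x)) \<partial>M)"
    by (intro nn_integral_mono ennreal_leI) simp
  also note assms(2)
  finally have "expectation (\<lambda>x. 1 + f x) \<le> 1"
    using assms(1) by (intro integral_le_if_nn_integral_le) auto
  then show ?thesis using assms(1) by (simp add: prob_space)
qed

text \<open>Half of the Donsker--Varadhan variational formula.\<close>

lemma integral_le_integral_ln_density:
  fixes r g :: "'a \<Rightarrow> real"
  assumes "prob_space (density P r)" and [measurable]: "r \<in> borel_measurable P" "g \<in> borel_measurable P"
    and int: "integrable (density P r) g" "integrable (density P r) (\<lambda>x. ln (r x))"
    and exp: "(\<integral>\<^sup>+ x. ennreal (exp (g x)) \<partial>P) \<le> ennreal (exp (- s))"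
  shows "(\<integral>x. g x \<partial>density P r) + s \<le> (\<integral>x. ln (r x) \<partial>density P r)"
proof -
  interpret Q: prob_space "density P r" by fact
  have "(\<integral>\<^sup>+ x. ennreal (exp (g x + s - ln (r x))) \<partial>density P r)
      = (\<integral>\<^sup>+ x. ennreal (r x) * ennreal (exp (g x + s - ln (r x))) \<partial>P)"
    by (subst nn_integral_density) auto
  \<comment> \<open>The factor \<open>r\<close> cancels where it is positive; where it vanishes the
    left side is 0, which is why only an inequality remains.\<close>
  also have "\<dots> \<le> (\<integral>\<^sup>+ x. ennreal (exp s) * ennreal (exp (g x)) \<partial>P)"
  proof (intro nn_integral_mono)
    fix x show "ennreal (r x) * ennreal (exp (g x + s - ln (r x))) \<le> ennreal (exp s) * ennreal (exp (g x))"
    proof (cases "r x > 0")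
      case True
      then show ?thesis by (simp add: exp_add exp_diff field_simps flip: ennreal_mult)
    qed (simp add: ennreal_neg)
  qed
  also have "\<dots> = ennreal (exp s) * (\<integral>\<^sup>+ x. ennreal (exp (g x)) \<partial>P)"
    by (rule nn_integral_cmult) auto
  also have "\<dots> \<le> ennreal (exp s) * ennreal (exp (- s))"
    by (intro mult_left_mono exp) auto
  also have "\<dots> = 1" by (simp flip: ennreal_mult add: exp_minus)
  finally have "Q.expectation (\<lambda>x. g x + s - ln (r x)) \<le> 0"
    using int by (intro Q.expectation_nonpos_if_exp) auto
  then show ?thesis using int by (simp add: Q.prob_space[simplified])
qed

text \<open>Gibbs' inequality is the variational bound for \<open>g = 0\<close> and
  \<open>s = 0\<close>.\<close>

lemma relative_entropy_nonneg:
  assumes "prob_space P" "prob_space Q"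
  shows "0 \<le> relative_entropy Q P"
proof (cases "relative_entropy Q P < \<infinity>")
  case True
  interpret P: prob_space P by fact
  from True obtain r :: "'a \<Rightarrow> real" where r: "r \<in> borel_measurable P" "Q = density P r"
    "integrable Q (\<lambda>x. ln (r x))" "relative_entropy Q P = ereal (\<integral>x. ln (r x) \<partial>Q)"
    using finite_relative_entropyE[OF assms] by metis
  have "(\<integral>x. 0 \<partial>density P r) + 0 \<le> (\<integral>x. ln (r x) \<partial>density P r)"
    using assms r by (intro integral_le_integral_ln_density) (auto simp: P.emeasure_space_1)
  then show ?thesis using r by simp
qed auto

section \<open>Exponential moments near zero\<close>

text \<open>A restriction on one side of \<open>x\<close> suffices, which suits random variables
  that are only bounded above.\<close>

lemma exp_le_quadratic:
  fixes x :: real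
  assumes "x \<le> 1"
  shows "exp x \<le> 1 + x + x\<^sup>2"
proof (cases "0 \<le> x")
  case False
  define y where "y = - x"
  have y: "0 < y" using False by (simp add: y_def)
  \<comment> \<open>The product is \<open>1 + y ^ 3\<close>.\<close>
  have "1 \<le> (1 - y + y\<^sup>2) * (1 + y)"
    using y by (simp add: algebra_simps power2_eq_square)
  also have "\<dots> \<le> (1 - y + y\<^sup>2) * exp y"
  proof (intro mult_left_mono)
    have "0 \<le> (1 - y)\<^sup>2 + y" using y by simp
    then show "0 \<le> 1 - y + y\<^sup>2"  by (simp add: power2_eq_square algebra_simps)
  qed (use exp_ge_add_one_self[of y] in auto)
  finally have "exp (- y) \<le> 1 - y + y\<^sup>2" by (simp add: exp_minus field_simps)
  then show ?thesis by (simp add: y_def)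
qed (use assms exp_bound in auto)

text \<open>The linear term of the expansion at 0 is negative because the mean lies below
  \<open>c\<close>, and the second moment controls the rest. Applied under a tilted law this is a
  Chernoff bound; applied under \<open>P\<close> it is the input for the positivity of the rate in
  (ii).\<close>

lemma (in prob_space) exp_moment_less_one:
  fixes f :: "'a \<Rightarrow> real"
  assumes f: "integrable M f" "integrable M (\<lambda>x. (f x)\<^sup>2)"
    and "AE x in M. f x \<le> m" "expectation f < c"
  shows "\<exists>\<theta>>0. \<exists>s>0. (\<integral>\<^sup>+ x. ennreal (exp (\<theta> * (f x - c))) \<partial>M) \<le> ennreal (exp (- s))"
proof -
  define g where "g x = f x - c" for x
  have g: "integrable M g" "integrable M (\<lambda>x. (g x)\<^sup>2)"
    using f by (auto simp: g_def[abs_def] power2_diff)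
  define d where "d = - expectation g"
  define v where "v = expectation (\<lambda>x. (g x)\<^sup>2)"
  have "expectation g = expectation f - c" using f by (simp add: g_def[abs_def] prob_space)
  then have d: "d > 0" using assms(4) by (simp add: d_def)
  have v: "v \<ge> 0" unfolding v_def by (simp add: integral_nonneg)
  \<comment> \<open>Almost everywhere \<open>g x \<le> k\<close>, so
    \<open>\<theta> \<le> 1 / k\<close> keeps \<open>\<theta> * g x\<close> below 1. The other bound
    on \<open>\<theta>\<close> lets the quadratic term consume at most half of the gain
    \<open>\<theta> * d\<close>; \<open>v + 1\<close> guards against \<open>v = 0\<close>.\<close>
  define k where "k = max (m - c) 0 + 1"
  define \<theta> where "\<theta> = min (1 / k) (d / (2 * (v + 1)))"
  have k: "k > 0" by (simp add: k_def)
  have \<theta>: "\<theta> > 0" using d v k by (simp add: \<theta>_def)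
  have "\<theta> * (v + 1) \<le> d / (2 * (v + 1)) * (v + 1)"
    using v by (intro mult_right_mono) (auto simp: \<theta>_def)
  also have "\<dots> = d / 2"
  proof -
    have "w \<noteq> 0 \<Longrightarrow> d / (2 * w) * w = d / 2" for w by simp
    then show ?thesis using v by (smt (verit))
  qed
  finally have \<theta>v: "\<theta> * v \<le> d / 2" using \<theta> by (simp add: distrib_left)
  have ae: "AE x in M. exp (\<theta> * g x) \<le> 1 + \<theta> * g x + \<theta>\<^sup>2 * (g x)\<^sup>2"
    using assms(3)
  proof eventually_elim
    case (elim x)
    have "\<theta> * g x \<le> \<theta> * k" using \<theta> elim by (intro mult_left_mono) (auto simp: g_def k_def)
    also have "\<dots> \<le> 1 / k * k" using k by (intro mult_right_mono) (auto simp: \<theta>_def)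
    finally have "\<theta> * g x \<le> 1" using k by simp
    from exp_le_quadratic[OF this] show ?case by (simp add: power_mult_distrib)
  qed
  have int: "integrable M (\<lambda>x. 1 + \<theta> * g x + \<theta>\<^sup>2 * (g x)\<^sup>2)" using g by auto
  have "(\<integral>\<^sup>+ x. ennreal (exp (\<theta> * g x)) \<partial>M) \<le> (\<integral>\<^sup>+ x. ennreal (1 + \<theta> * g x + \<theta>\<^sup>2 * (g x)\<^sup>2) \<partial>M)"
    using ae by (intro nn_integral_mono_AE) (auto simp: ennreal_leI)
  also have "\<dots> = ennreal (expectation (\<lambda>x. 1 + \<theta> * g x + \<theta>\<^sup>2 * (g x)\<^sup>2))"
    using ae by (intro nn_integral_eq_integral int) (auto elim!: eventually_mono intro: order_trans[OF exp_ge_zero])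
  also have "expectation (\<lambda>x. 1 + \<theta> * g x + \<theta>\<^sup>2 * (g x)\<^sup>2) = 1 - \<theta> * d + \<theta> * (\<theta> * v)"
    using g by (simp add: prob_space d_def v_def power2_eq_square)
  also have "\<dots> \<le> 1 - \<theta> * d + \<theta> * (d / 2)"
    using \<theta> by (intro add_left_mono mult_left_mono \<theta>v) auto
  also have "\<dots> \<le> exp (- (\<theta> * d / 2))"
    using exp_ge_add_one_self[of "- (\<theta> * d / 2)"] by (simp add: field_simps)
  finally have "(\<integral>\<^sup>+ x. ennreal (exp (\<theta> * g x)) \<partial>M) \<le> ennreal (exp (- (\<theta> * d / 2)))"
    by (simp add: ennreal_leI)
  moreover have "\<theta> * d / 2 > 0" using \<theta> d by simp
  ultimately show ?thesis using \<theta> unfolding g_def by blast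
qed

section \<open>Independent samples and the lower bound for bounded data\<close>

locale iid_process = prob_space M for M :: "'a measure" +
  fixes X :: "nat \<Rightarrow> 'a \<Rightarrow> real" and P :: "real measure"
  assumes indep: "indep_vars (\<lambda>_. borel) X UNIV"
    and distr_X: "\<And>i. distr M borel (X i) = P"
begin

lemma measurable_X [measurable]: "X i \<in> borel_measurable M"
  using indep by (auto simp: indep_vars_def)

lemma sets_P [simp, measurable_cong]: "sets P = sets borel"
  using distr_X[of 0] by auto

lemma space_P [simp]: "space P = UNIV"
  using distr_X[of 0] by auto

lemma prob_space_P: "prob_space P"
  using prob_space_distr[OF measurable_X[of 0]] distr_X[of 0] by simp

lemma nn_integral_X: "g \<in> borel_measurable borel \<Longrightarrow> (\<integral>\<^sup>+ \<omega>. g (X i \<omega>) \<partial>M) = (\<integral>\<^sup>+ x. g x \<partial>P)"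
  unfolding distr_X[of i, symmetric] by (subst nn_integral_distr) auto

lemma integrable_X:
  fixes g :: "real \<Rightarrow> real"
  shows "g \<in> borel_measurable borel \<Longrightarrow> integrable M (\<lambda>\<omega>. g (X i \<omega>)) \<longleftrightarrow> integrable P g"
  unfolding distr_X[of i, symmetric] by (subst integrable_distr_eq) auto

lemma expectation_X:
  fixes g :: "real \<Rightarrow> real"
  shows "g \<in> borel_measurable borel \<Longrightarrow> expectation (\<lambda>\<omega>. g (X i \<omega>)) = (\<integral>x. g x \<partial>P)"
  unfolding distr_X[of i, symmetric] by (subst integral_distr) auto

text \<open>For \<open>g\<close> a probability density with respect to \<open>P\<close> this says
  that the likelihood ratio has mean 1; with an extra exponential factor in \<open>g\<close> it
  gives the Chernoff bound.\<close>

lemma nn_integral_prod_X: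
  fixes g :: "real \<Rightarrow> ennreal"
  assumes [measurable]: "g \<in> borel_measurable borel"
  shows "(\<integral>\<^sup>+ \<omega>. (\<Prod>i=1..n. g (X i \<omega>)) \<partial>M) = (\<integral>\<^sup>+ x. g x \<partial>P) ^ n"
proof -
  have "indep_vars (\<lambda>_. borel) (\<lambda>i \<omega>. g (X i \<omega>)) {1..n}"
    by (rule indep_vars_compose2[OF indep_vars_subset[OF indep]]) auto
  then have "(\<integral>\<^sup>+ \<omega>. (\<Prod>i=1..n. g (X i \<omega>)) \<partial>M) = (\<Prod>i=1..n. \<integral>\<^sup>+ \<omega>. g (X i \<omega>) \<partial>M)"
    by (intro indep_vars_nn_integral) auto
  then show ?thesis by (simp add: nn_integral_X)
qed

text \<open>Weighting by the product of the \<open>r (X i \<omega>)\<close> yields the probability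
  of the event for independent draws from \<open>density P r\<close>, without building a product
  space. Exponential Markov and independence bound it by \<open>exp (- s) ^ n\<close>.\<close>

lemma tilted_chernoff:
  fixes r f :: "real \<Rightarrow> real"
  assumes "prob_space (density P r)" and [measurable]: "r \<in> borel_measurable borel" "f \<in> borel_measurable borel"
    and nn: "\<And>x. 0 \<le> r x"
    and f: "integrable (density P r) f" "integrable (density P r) (\<lambda>x. (f x)\<^sup>2)"
    and "AE x in density P r. f x \<le> m" "(\<integral>x. f x \<partial>density P r) < c"
  shows "(\<lambda>n. \<integral>\<^sup>+ \<omega>. ennreal (\<Prod>i=1..n. r (X i \<omega>)) *
      indicator {\<omega> \<in> space M. real n * c \<le> (\<Sum>i=1..n. f (X i \<omega>))} \<omega> \<partial>M) \<longlonglongrightarrow> 0"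
proof -
  obtain \<theta> s where \<theta>: "\<theta> > 0" and s: "s > 0"
    and le: "(\<integral>\<^sup>+ x. ennreal (exp (\<theta> * (f x - c))) \<partial>density P r) \<le> ennreal (exp (- s))"
    using prob_space.exp_moment_less_one[OF assms(1) f assms(7,8)] by blast
  have le: "(\<integral>\<^sup>+ \<omega>. ennreal (\<Prod>i=1..n. r (X i \<omega>)) *
      indicator {\<omega> \<in> space M. real n * c \<le> (\<Sum>i=1..n. f (X i \<omega>))} \<omega> \<partial>M) \<le> ennreal (exp (- s) ^ n)" for n
  proof -
    have "(\<integral>\<^sup>+ \<omega>. ennreal (\<Prod>i=1..n. r (X i \<omega>)) *
        indicator {\<omega> \<in> space M. real n * c \<le> (\<Sum>i=1..n. f (X i \<omega>))} \<omega> \<partial>M)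
      \<le> (\<integral>\<^sup>+ \<omega>. (\<Prod>i=1..n. ennreal (r (X i \<omega>)) * ennreal (exp (\<theta> * (f (X i \<omega>) - c)))) \<partial>M)"
    proof (intro nn_integral_mono)
      fix \<omega>
      have *: "(\<Prod>i=1..n. ennreal (r (X i \<omega>)) * ennreal (exp (\<theta> * (f (X i \<omega>) - c))))
          = ennreal (\<Prod>i=1..n. r (X i \<omega>)) * ennreal (exp (\<theta> * ((\<Sum>i=1..n. f (X i \<omega>)) - real n * c)))"
      proof -
        have "(\<Prod>i=1..n. exp (\<theta> * (f (X i \<omega>) - c))) = exp (\<theta> * ((\<Sum>i=1..n. f (X i \<omega>)) - real n * c))"
          by (simp add: sum_subtractf flip: exp_sum sum_distrib_left)
        then show ?thesis using nn by (simp add: prod.distrib prod_ennreal)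
      qed
      \<comment> \<open>Markov's inequality pointwise: on the event the exponent is
        nonnegative.\<close>
      have "indicator {\<omega> \<in> space M. real n * c \<le> (\<Sum>i=1..n. f (X i \<omega>))} \<omega>
          \<le> ennreal (exp (\<theta> * ((\<Sum>i=1..n. f (X i \<omega>)) - real n * c)))"
        using \<theta> by (auto simp: indicator_def)
      then show "ennreal (\<Prod>i=1..n. r (X i \<omega>)) *
          indicator {\<omega> \<in> space M. real n * c \<le> (\<Sum>i=1..n. f (X i \<omega>))} \<omega>
        \<le> (\<Prod>i=1..n. ennreal (r (X i \<omega>)) * ennreal (exp (\<theta> * (f (X i \<omega>) - c))))"
        unfolding * by (intro mult_left_mono) auto
    qed
    also have "\<dots> = (\<integral>\<^sup>+ x. ennreal (r x) * ennreal (exp (\<theta> * (f x - c))) \<partial>P) ^ n"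
      by (rule nn_integral_prod_X) measurable
    also have "(\<integral>\<^sup>+ x. ennreal (r x) * ennreal (exp (\<theta> * (f x - c))) \<partial>P)
        = (\<integral>\<^sup>+ x. ennreal (exp (\<theta> * (f x - c))) \<partial>density P r)"
      by (subst nn_integral_density) auto
    also have "\<dots> ^ n \<le> ennreal (exp (- s)) ^ n" by (intro power_mono le) auto
    finally show ?thesis by (simp add: ennreal_power)
  qed
  have lim: "(\<lambda>n. ennreal (exp (- s) ^ n)) \<longlonglongrightarrow> 0"
    unfolding ennreal_0[symmetric] using s by (intro tendsto_ennrealI LIMSEQ_power_zero) auto
  show ?thesis
    by (rule tendsto_sandwich[OF always_eventually always_eventually tendsto_const lim]) (simp_all only: le zero_le simp_thms)
qed

text \<open>
  Change of measure: the weights \<open>D n\<close> turn the \<open>X i\<close> into an i.i.d. sequence with law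
  \<open>density P r\<close>, under which the event and \<open>D n < exp (n h')\<close> are typical by \<open>tilted_chernoff\<close>.
\<close>

lemma deviation_lower_bound_bounded:
  fixes r F U :: "real \<Rightarrow> real"
  assumes "prob_space (density P r)"
    and [measurable]: "r \<in> borel_measurable borel" "F \<in> borel_measurable borel" "U \<in> borel_measurable borel"
    and nn: "\<And>x. 0 \<le> r x"
    and bd: "\<And>x. 0 < r x \<Longrightarrow> \<bar>F x\<bar> \<le> K \<and> \<bar>U x\<bar> \<le> K \<and> \<bar>ln (r x)\<bar> \<le> K"
    and a: "a < (\<integral>x. F x \<partial>density P r)" and b: "(\<integral>x. U x \<partial>density P r) < b"
    and h: "(\<integral>x. ln (r x) \<partial>density P r) < h"
  shows "\<forall>\<^sub>F n in sequentially.
    exp (- real n * h) \<le> prob {\<omega> \<in> space M. real n * a < (\<Sum>i=1..n. F (X i \<omega>)) \<and> (\<Sum>i=1..n. U (X i \<omega>)) < real n * b}"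
proof -
  interpret P: prob_space P by (rule prob_space_P)
  let ?Q = "density P r"
  interpret Q: prob_space ?Q by fact
  define D where "D n \<omega> = (\<Prod>i=1..n. r (X i \<omega>))" for n \<omega>
  have [measurable]: "D n \<in> borel_measurable M" for n unfolding D_def by measurable
  have D0: "0 \<le> D n \<omega>" for n \<omega> unfolding D_def by (intro prod_nonneg) (simp add: nn)
  have D1: "(\<integral>\<^sup>+ \<omega>. ennreal (D n \<omega>) \<partial>M) = 1" for n
  proof -
    have "(\<integral>\<^sup>+ x. ennreal (r x) \<partial>P) = emeasure ?Q UNIV" by (subst emeasure_density) auto
    also have "\<dots> = 1" using Q.emeasure_space_1 by simp
    finally show ?thesis
      using nn_integral_prod_X[of "\<lambda>x. ennreal (r x)" n] nn by (simp add: D_def prod_ennreal)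
  qed
  \<comment> \<open>The gap between \<open>h'\<close> and \<open>h\<close> later absorbs the factor
    1/2 in front of the probability, as soon as \<open>ln 2 \<le> real n * (h - h')\<close>.\<close>
  obtain h' where h': "(\<integral>x. ln (r x) \<partial>?Q) < h'" "h' < h" using h dense by blast
  have pos: "AE x in ?Q. 0 < r x" by (intro AE_density_pos) simp
  have ch: "(\<lambda>n. \<integral>\<^sup>+ \<omega>. ennreal (D n \<omega>) *
      indicator {\<omega> \<in> space M. real n * c \<le> (\<Sum>i=1..n. f (X i \<omega>))} \<omega> \<partial>M) \<longlonglongrightarrow> 0"
    if [measurable]: "f \<in> borel_measurable borel" and fK: "\<And>x. 0 < r x \<Longrightarrow> \<bar>f x\<bar> \<le> K"
      and c: "(\<integral>x. f x \<partial>?Q) < c" for f c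
    unfolding D_def
  proof (rule tilted_chernoff[OF assms(1,2) that(1) nn _ _ _ c])
    show "integrable ?Q f"
      using pos by (intro Q.integrable_const_bound[of _ K]) (auto elim!: eventually_mono intro: fK)
    show "integrable ?Q (\<lambda>x. (f x)\<^sup>2)"
    proof (intro Q.integrable_const_bound[of _ "K\<^sup>2"])
      show "AE x in ?Q. norm ((f x)\<^sup>2) \<le> K\<^sup>2"
        using pos
      proof eventually_elim
        case (elim x)
        then show ?case using power_mono[OF fK[OF elim], of 2] by simp
      qed
    qed auto
    show "AE x in ?Q. f x \<le> K"
      using pos by eventually_elim (drule fK, simp)
  qed
  define B where "B f c n = {\<omega> \<in> space M. real n * c \<le> (\<Sum>i=1..n. f (X i \<omega>))}" for f :: "real \<Rightarrow> real" and c n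
  define A where "A n = {\<omega> \<in> space M. real n * a < (\<Sum>i=1..n. F (X i \<omega>)) \<and> (\<Sum>i=1..n. U (X i \<omega>)) < real n * b}" for n
  have [measurable]: "A n \<in> sets M" for n unfolding A_def by measurable
  have [measurable]: "B f c n \<in> sets M" if [measurable]: "f \<in> borel_measurable borel" for f c n
    unfolding B_def by measurable
  let ?e = "\<lambda>f c n. \<integral>\<^sup>+ \<omega>. ennreal (D n \<omega>) * indicator (B f c n) \<omega> \<partial>M"
  \<comment> \<open>Three ways to fail under the tilted law: the sum of \<open>F\<close> is too
    small (hence the reflected function and level), the sum of \<open>U\<close> is too large, or the
    log-likelihood is too large.\<close>
  let ?err = "\<lambda>n. ?e (\<lambda>x. - F x) (- a) n + ?e U b n + ?e (\<lambda>x. ln (r x)) h' n"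
  have "?err \<longlonglongrightarrow> 0 + 0 + 0"
    unfolding B_def
  proof (intro tendsto_add ch)
    show "(\<integral>x. - F x \<partial>?Q) < - a" using a by simp
  qed (use b h' bd in \<open>simp_all\<close>)
  then have "\<forall>\<^sub>F n in sequentially. ?err n < ennreal (1/2)"
    by (rule order_tendstoD(2)) (simp add: ennreal_less_zero_iff del: ennreal_half)
  moreover have "\<forall>\<^sub>F n in sequentially. ln 2 \<le> real n * (h - h')"
  proof (intro eventually_sequentiallyI[of "nat \<lceil>ln 2 / (h - h')\<rceil>"])
    fix n assume "nat \<lceil>ln 2 / (h - h')\<rceil> \<le> n"
    then have "ln 2 / (h - h') \<le> real n" by linarith
    then show "ln 2 \<le> real n * (h - h')" using h' by (simp add: field_simps)
  qed
  ultimately show ?thesis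
    unfolding A_def[symmetric]
  proof eventually_elim
    case (elim n)
    have "1 = (\<integral>\<^sup>+ \<omega>. ennreal (D n \<omega>) \<partial>M)" by (simp add: D1)
    \<comment> \<open>Outside the three failure sets the event holds and \<open>D n\<close> is at
      most \<open>exp (real n * h')\<close>. Integrating gives 1 on the left and an error below 1/2
      on the right.\<close>
    also have "\<dots> \<le> (\<integral>\<^sup>+ \<omega>. ennreal (exp (real n * h')) * indicator (A n) \<omega>
       + (ennreal (D n \<omega>) * indicator (B (\<lambda>x. - F x) (- a) n) \<omega> + ennreal (D n \<omega>) * indicator (B U b n) \<omega>
       + ennreal (D n \<omega>) * indicator (B (\<lambda>x. ln (r x)) h' n) \<omega>) \<partial>M)"
    proof (intro nn_integral_mono)
      have aux: "x \<le> y + (x + z + w)" "x \<le> y + (z + x + w)" "x \<le> y + (z + w + x)" for x y z w :: ennreal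
        unfolding le_iff_add by (rule exI[of _ "y + z + w"], simp add: ac_simps)+
      fix \<omega> assume \<omega>: "\<omega> \<in> space M"
      consider (good) "\<omega> \<in> A n" "\<omega> \<notin> B (\<lambda>x. ln (r x)) h' n" | (1) "\<omega> \<in> B (\<lambda>x. - F x) (- a) n" | (2) "\<omega> \<in> B U b n"
        | (3) "\<omega> \<in> B (\<lambda>x. ln (r x)) h' n"
        using \<omega> unfolding A_def B_def mem_Collect_eq sum_negf by argo
      then show "ennreal (D n \<omega>) \<le> ennreal (exp (real n * h')) * indicator (A n) \<omega>
       + (ennreal (D n \<omega>) * indicator (B (\<lambda>x. - F x) (- a) n) \<omega> + ennreal (D n \<omega>) * indicator (B U b n) \<omega>
       + ennreal (D n \<omega>) * indicator (B (\<lambda>x. ln (r x)) h' n) \<omega>)"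
      proof cases
        case good
        have "D n \<omega> \<le> exp (real n * h')"
        \<comment> \<open>A vanishing factor breaks the identity with the exponential of the
          log-sum, because \<open>ln 0 = 0\<close>; but then the whole product is 0.\<close>
        proof (cases "\<forall>i\<in>{1..n}. 0 < r (X i \<omega>)")
          case True
          then have "D n \<omega> = exp (\<Sum>i=1..n. ln (r (X i \<omega>)))"
            by (simp add: D_def exp_sum)
          also have "\<dots> \<le> exp (real n * h')" using good \<omega> by (simp add: B_def)
          finally show ?thesis .
        next
          case False
          then obtain i where "i \<in> {1..n}" "r (X i \<omega>) = 0" using nn by (meson antisym not_less)
          then have "D n \<omega> = 0" unfolding D_def by (intro prod_zero) auto
          then show ?thesis by simp
        qed
        then show ?thesis using good by (intro add_increasing2) (auto simp: ennreal_leI)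
      qed (simp_all only: indicator_simps mult_1_right aux)
    qed
    also have "\<dots> = ennreal (exp (real n * h')) * emeasure M (A n) + ?err n"
      by (simp add: nn_integral_add nn_integral_cmult_indicator)
    also have "\<dots> \<le> ennreal (exp (real n * h')) * ennreal (prob (A n)) + ennreal (1/2)"
      using elim by (intro add_mono) (auto simp: emeasure_eq_measure)
    also have "\<dots> = ennreal (exp (real n * h') * prob (A n) + 1/2)"
      by (subst ennreal_plus) (auto simp: ennreal_mult)
    finally have "ennreal 1 \<le> ennreal (exp (real n * h') * prob (A n) + 1/2)"
      by (simp only: ennreal_1)
    then have "1 \<le> exp (real n * h') * prob (A n) + 1/2"
      by (subst (asm) ennreal_le_iff) auto
    then have "exp (- real n * h') / 2 \<le> prob (A n)"
      by (simp add: exp_minus field_simps)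
    moreover have "exp (- real n * h) \<le> exp (- real n * h' - ln 2)"
      using elim by (simp add: algebra_simps)
    ultimately show ?case by (simp add: exp_diff)
  qed
qed

end

section \<open>Removing boundedness by truncation\<close>

lemma indicator_truncation_tendsto_integral:
  fixes g :: "'a \<Rightarrow> real" and A :: "nat \<Rightarrow> 'a set"
  assumes "integrable M g" and [measurable]: "\<And>k. A k \<in> sets M"
    and "AE x in M. \<forall>\<^sub>F k in sequentially. x \<in> A k"
  shows "(\<lambda>k. \<integral>x. indicator (A k) x * g x \<partial>M) \<longlonglongrightarrow> (\<integral>x. g x \<partial>M)"
proof (rule integral_dominated_convergence[where w = "\<lambda>x. \<bar>g x\<bar>"])
  have [measurable]: "g \<in> borel_measurable M" using assms(1) by auto
  show "g \<in> borel_measurable M" "\<And>k. (\<lambda>x. indicator (A k) x * g x) \<in> borel_measurable M"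
    by measurable
  show "AE x in M. (\<lambda>k. indicator (A k) x * g x) \<longlonglongrightarrow> g x"
    using assms(3)
  proof eventually_elim
    case (elim x)
    then have "\<forall>\<^sub>F k in sequentially. indicator (A k) x * g x = g x"
      by eventually_elim simp
    then show ?case by (rule tendsto_eventually)
  qed
qed (use assms(1) in \<open>auto simp: indicator_def\<close>)

context iid_process
begin

text \<open>All three hypotheses on the means are strict, so they survive conditioning the tilted
  law on a set \<open>A k\<close> of mass close to 1, on which the data are bounded.\<close>

lemma deviation_lower_bound:
  fixes r F U :: "real \<Rightarrow> real"
  assumes Q: "prob_space (density P r)"
    and [measurable]: "r \<in> borel_measurable borel" "F \<in> borel_measurable borel" "U \<in> borel_measurable borel"
    and nn: "\<And>x. 0 \<le> r x"
    and F: "integrable (density P r) F" and U: "integrable (density P r) U"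
    and ln: "integrable (density P r) (\<lambda>x. ln (r x))"
    and a: "a < (\<integral>x. F x \<partial>density P r)" and b: "(\<integral>x. U x \<partial>density P r) < b"
    and h: "(\<integral>x. ln (r x) \<partial>density P r) < h"
  shows "\<forall>\<^sub>F n in sequentially.
    exp (- real n * h) \<le> prob {\<omega> \<in> space M. real n * a < (\<Sum>i=1..n. F (X i \<omega>)) \<and> (\<Sum>i=1..n. U (X i \<omega>)) < real n * b}"
proof -
  let ?Q = "density P r"
  interpret Q: prob_space ?Q by fact
  \<comment> \<open>\<open>c k\<close> is the mass of \<open>A k\<close> under the tilted law and
    \<open>t k\<close> the density of that law conditioned on \<open>A k\<close>. Requiring
    \<open>0 < r x\<close> makes the logarithm of the quotient split.\<close>
  define A where "A k = {x. 0 < r x \<and> \<bar>F x\<bar> \<le> real k \<and> \<bar>U x\<bar> \<le> real k \<and> \<bar>ln (r x)\<bar> \<le> real k}" for k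
  have A[measurable]: "A k \<in> sets borel" for k unfolding A_def by measurable
  define c where "c k = Q.prob (A k)" for k
  define t where "t k x = indicator (A k) x * r x / c k" for k and x :: real
  have t[measurable]: "t k \<in> borel_measurable borel" for k unfolding t_def by measurable
  have t0: "0 \<le> t k x" for k x using nn by (simp add: t_def c_def)
  have "AE x in ?Q. 0 < r x" by (intro AE_density_pos) simp
  then have ev: "AE x in ?Q. \<forall>\<^sub>F k in sequentially. x \<in> A k"
  proof eventually_elim
    case (elim x)
    show ?case
    proof (intro eventually_sequentiallyI[of "nat \<lceil>max \<bar>F x\<bar> (max \<bar>U x\<bar> \<bar>ln (r x)\<bar>)\<rceil>"])
      fix k assume "nat \<lceil>max \<bar>F x\<bar> (max \<bar>U x\<bar> \<bar>ln (r x)\<bar>)\<rceil> \<le> k"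
      then have "max \<bar>F x\<bar> (max \<bar>U x\<bar> \<bar>ln (r x)\<bar>) \<le> real k" by linarith
      then show "x \<in> A k" using elim by (auto simp: A_def)
    qed
  qed
  have trunc: "(\<lambda>k. \<integral>x. indicator (A k) x * g x \<partial>?Q) \<longlonglongrightarrow> (\<integral>x. g x \<partial>?Q)" if "integrable ?Q g" for g :: "real \<Rightarrow> real"
    by (intro indicator_truncation_tendsto_integral that ev) auto
  have c: "c \<longlonglongrightarrow> 1"
    using trunc[of "\<lambda>_. 1"] by (simp add: c_def[abs_def] Q.prob_space[simplified])
  have int_t: "(\<integral>x. g x \<partial>density P (t k)) = (\<integral>x. indicator (A k) x * g x \<partial>?Q) / c k"
    if [measurable]: "g \<in> borel_measurable borel" for g :: "real \<Rightarrow> real" and k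
  proof -
    have "(\<integral>x. g x \<partial>density P (t k)) = (\<integral>x. (r x * (indicator (A k) x * g x)) / c k \<partial>P)"
      using t0 by (subst integral_density) (auto simp: t_def mult_ac)
    also have "\<dots> = (\<integral>x. indicator (A k) x * g x \<partial>?Q) / c k"
      using nn by (subst integral_density) auto
    finally show ?thesis .
  qed
  have lim: "(\<lambda>k. \<integral>x. g x \<partial>density P (t k)) \<longlonglongrightarrow> (\<integral>x. g x \<partial>?Q)"
    if [measurable]: "g \<in> borel_measurable borel" and "integrable ?Q g" for g :: "real \<Rightarrow> real"
    using tendsto_divide[OF trunc[OF that(2)] c] by (simp add: int_t)
  have prob_t: "prob_space (density P (t k))" if "0 < c k" for k
  proof
    have "emeasure (density P (t k)) UNIV = (\<integral>\<^sup>+x. ennreal (t k x) \<partial>P)"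
      by (subst emeasure_density) auto
    also have "\<dots> = (\<integral>\<^sup>+x. ennreal (r x) * (indicator (A k) x * ennreal (1 / c k)) \<partial>P)"
      using nn by (intro nn_integral_cong) (auto simp: t_def indicator_def simp flip: ennreal_mult')
    also have "\<dots> = (\<integral>\<^sup>+x. indicator (A k) x * ennreal (1 / c k) \<partial>?Q)"
      by (subst nn_integral_density) auto
    also have "\<dots> = emeasure ?Q (A k) * ennreal (1 / c k)"
      by (subst nn_integral_multc) auto
    also have "\<dots> = 1"
      using that by (simp add: Q.emeasure_eq_measure c_def flip: ennreal_mult)
    finally show "emeasure (density P (t k)) (space (density P (t k))) = 1" by simp
  qed
  \<comment> \<open>The expression is the entropy of the conditioned law: normalising by
    \<open>c k\<close> costs \<open>- ln (c k)\<close>, which tends to 0.\<close>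
  have "(\<lambda>k. (\<integral>x. ln (r x) \<partial>density P (t k)) - ln (c k)) \<longlonglongrightarrow> (\<integral>x. ln (r x) \<partial>?Q) - ln 1"
    by (intro tendsto_diff lim tendsto_ln c ln) auto
  then have "\<forall>\<^sub>F k in sequentially. (\<integral>x. ln (r x) \<partial>density P (t k)) - ln (c k) < h"
    using h by (intro order_tendstoD) auto
  moreover have "\<forall>\<^sub>F k in sequentially. 0 < c k" using c by (rule order_tendstoD) auto
  moreover have "\<forall>\<^sub>F k in sequentially. a < (\<integral>x. F x \<partial>density P (t k))"
    by (rule order_tendstoD(1)[OF lim a]) (auto intro: F)
  moreover have "\<forall>\<^sub>F k in sequentially. (\<integral>x. U x \<partial>density P (t k)) < b"
    by (rule order_tendstoD(2)[OF lim b]) (auto intro: U)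
  ultimately have "\<forall>\<^sub>F k in sequentially. 0 < c k \<and> a < (\<integral>x. F x \<partial>density P (t k)) \<and>
      (\<integral>x. U x \<partial>density P (t k)) < b \<and> (\<integral>x. ln (r x) \<partial>density P (t k)) - ln (c k) < h"
    by eventually_elim auto
  then obtain k where k: "0 < c k" "a < (\<integral>x. F x \<partial>density P (t k))"
      "(\<integral>x. U x \<partial>density P (t k)) < b" "(\<integral>x. ln (r x) \<partial>density P (t k)) - ln (c k) < h"
    using eventually_happens'[OF sequentially_bot] by blast
  interpret T: prob_space "density P (t k)" using k prob_t by auto
  have tA: "x \<in> A k \<and> ln (t k x) = ln (r x) - ln (c k)" if "0 < t k x" for x
    using that k by (auto simp: t_def indicator_def A_def ln_div split: if_splits)
  have pos: "AE x in density P (t k). 0 < t k x" by (intro AE_density_pos) simp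
  have int: "integrable (density P (t k)) (\<lambda>x. ln (r x))"
  proof (intro T.integrable_const_bound[of _ "real k"])
    show "AE x in density P (t k). norm (ln (r x)) \<le> real k"
      using pos by eventually_elim (drule tA, simp add: A_def)
  qed auto
  have "(\<integral>x. ln (t k x) \<partial>density P (t k)) = (\<integral>x. ln (r x) - ln (c k) \<partial>density P (t k))"
    using pos by (intro integral_cong_AE) (auto elim!: eventually_mono dest: tA)
  also have "\<dots> = (\<integral>x. ln (r x) \<partial>density P (t k)) - ln (c k)"
    using int T.prob_space by simp
  finally have "(\<integral>x. ln (t k x) \<partial>density P (t k)) < h" using k by simp
  \<comment> \<open>A common bound for all three functions: normalisation shifts the log-density by
    \<open>ln (c k)\<close>.\<close>
  moreover have "\<bar>F x\<bar> \<le> real k + \<bar>ln (c k)\<bar> \<and> \<bar>U x\<bar> \<le> real k + \<bar>ln (c k)\<bar> \<and> \<bar>ln (t k x)\<bar> \<le> real k + \<bar>ln (c k)\<bar>"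
    if "0 < t k x" for x
    using tA[OF that] unfolding A_def by auto
  ultimately show ?thesis
    using k t0 T.prob_space_axioms by (intro deviation_lower_bound_bounded[of "t k"]) auto
qed

section \<open>The upper bound by conditioning on the event\<close>

text \<open>The conclusion is non-asymptotic: the density exhibited for this \<open>n\<close>
  satisfies the constraints exactly. Independence is used only under \<open>M\<close>, for the mean
  of the product; it may fail under the conditioned measure.\<close>

lemma deviation_upper_bound:
  fixes F U :: "real \<Rightarrow> real" and a b :: real
  assumes [measurable]: "F \<in> borel_measurable borel" "U \<in> borel_measurable borel"
    and F: "integrable P F" and U: "integrable P U" and n: "0 < n"
  defines "A \<equiv> {\<omega> \<in> space M. real n * a < (\<Sum>i=1..n. F (X i \<omega>)) \<and> (\<Sum>i=1..n. U (X i \<omega>)) < real n * b}"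
  assumes p: "0 < prob A"
  shows "\<exists>r. r \<in> borel_measurable borel \<and> (\<forall>x. 0 \<le> r x) \<and> prob_space (density P r) \<and>
    integrable (density P r) F \<and> integrable (density P r) U \<and> integrable (density P r) (\<lambda>x. ln (r x)) \<and>
    a < (\<integral>x. F x \<partial>density P r) \<and> (\<integral>x. U x \<partial>density P r) < b \<and>
    real n * (\<integral>x. ln (r x) \<partial>density P r) \<le> - ln (prob A)"
proof -
  interpret P: prob_space P by (rule prob_space_P)
  have [measurable]: "A \<in> sets M" unfolding A_def by measurable
  define V where "V = uniform_measure M A"
  have [measurable_cong, simp]: "sets V = sets M" by (simp add: V_def)
  have em: "emeasure M A = ennreal (prob A)" by (rule emeasure_eq_measure)
  interpret V: prob_space V
    unfolding V_def using p by (intro prob_space_uniform_measure) (auto simp: em)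
  \<comment> \<open>Conditioning multiplies nonnegative integrals by at most
    \<open>1 / prob A\<close>. This one estimate gives absolute continuity, integrability under the
    new law, and the bound on the product of densities.\<close>
  have V_le: "(\<integral>\<^sup>+ \<omega>. g \<omega> \<partial>V) \<le> ennreal (1 / prob A) * (\<integral>\<^sup>+ \<omega>. g \<omega> \<partial>M)"
    if [measurable]: "g \<in> borel_measurable M" for g
  proof -
    have "(\<integral>\<^sup>+ \<omega>. g \<omega> \<partial>V) = (\<integral>\<^sup>+ \<omega>. g \<omega> * indicator A \<omega> \<partial>M) / ennreal (prob A)"
      unfolding V_def by (subst nn_integral_uniform_measure) (auto simp: em)
    also have "\<dots> \<le> (\<integral>\<^sup>+ \<omega>. g \<omega> \<partial>M) / ennreal (prob A)"
      by (intro divide_right_mono_ennreal nn_integral_mono) (auto simp: indicator_def)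
    also have "\<dots> = ennreal (1 / prob A) * (\<integral>\<^sup>+ \<omega>. g \<omega> \<partial>M)"
      using p by (simp add: divide_ennreal_def inverse_ennreal mult.commute inverse_eq_divide)
    finally show ?thesis .
  qed
  \<comment> \<open>The event is symmetric in \<open>X 1\<close>, ..., \<open>X n\<close>, so these
    laws coincide for such \<open>i\<close>; averaging them avoids having to prove
    exchangeability.\<close>
  define N where "N i = distr V borel (X i)" for i
  have ac: "absolutely_continuous P (N i)" for i
    unfolding absolutely_continuous_def
  proof safe
    fix B assume B: "B \<in> null_sets P"
    then have [measurable]: "B \<in> sets borel" by auto
    have "emeasure (N i) B = (\<integral>\<^sup>+ \<omega>. indicator B (X i \<omega>) \<partial>V)"
      unfolding N_def by (simp add: nn_integral_distr flip: nn_integral_indicator)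
    also have "\<dots> \<le> ennreal (1 / prob A) * (\<integral>\<^sup>+ \<omega>. indicator B (X i \<omega>) \<partial>M)"
      by (intro V_le) auto
    also have "(\<integral>\<^sup>+ \<omega>. indicator B (X i \<omega>) \<partial>M) = emeasure P B"
      by (subst nn_integral_X) auto
    also have "\<dots> = 0" using B by auto
    finally show "B \<in> null_sets (N i)" by (auto simp: null_sets_def N_def)
  qed
  define q where "q x = (\<Sum>i=1..n. RN_deriv P (N i) x) / of_nat n" for x
  have q[measurable]: "q \<in> borel_measurable borel"
    unfolding q_def by (auto intro!: borel_measurable_divide_ennreal borel_measurable_sum simp flip: measurable_cong_sets[OF sets_P refl])
  have q_int: "(\<integral>\<^sup>+ x. q x * g x \<partial>P) = (\<Sum>i=1..n. \<integral>\<^sup>+ \<omega>. g (X i \<omega>) \<partial>V) / of_nat n"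
    if [measurable]: "g \<in> borel_measurable borel" for g
  proof -
    have [measurable]: "RN_deriv P (N i) \<in> borel_measurable borel" for i
      by (simp flip: measurable_cong_sets[OF sets_P refl])
    have "(\<integral>\<^sup>+ x. q x * g x \<partial>P) = (\<integral>\<^sup>+ x. (\<Sum>i=1..n. RN_deriv P (N i) x * g x) / of_nat n \<partial>P)"
      by (simp add: q_def divide_ennreal_def mult_ac flip: sum_distrib_left sum_distrib_right)
    also have "\<dots> = (\<integral>\<^sup>+ x. (\<Sum>i=1..n. RN_deriv P (N i) x * g x) \<partial>P) / of_nat n"
      by (rule nn_integral_divide) measurable
    also have "(\<integral>\<^sup>+ x. (\<Sum>i=1..n. RN_deriv P (N i) x * g x) \<partial>P) = (\<Sum>i=1..n. \<integral>\<^sup>+ x. RN_deriv P (N i) x * g x \<partial>P)"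
      by (rule nn_integral_sum) measurable
    also have "\<dots> = (\<Sum>i=1..n. \<integral>\<^sup>+ x. g x \<partial>N i)"
      by (intro sum.cong refl P.RN_deriv_nn_integral[symmetric] ac) (auto simp: N_def)
    also have "\<dots> = (\<Sum>i=1..n. \<integral>\<^sup>+ \<omega>. g (X i \<omega>) \<partial>V)"
      unfolding N_def by (intro sum.cong refl nn_integral_distr) auto
    finally show ?thesis .
  qed
  have n': "of_nat n \<noteq> (0::ennreal)" "of_nat n \<noteq> (top::ennreal)" using n by auto
  have n1: "of_nat n / of_nat n = (1::ennreal)"
    using n' by (intro ennreal_divide_self) (auto intro: of_nat_less_top)
  have "(\<integral>\<^sup>+ x. q x \<partial>P) = 1"
    using q_int[of "\<lambda>_. 1"] by (simp add: V.emeasure_space_1[simplified] n1)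
  then have q_fin: "AE x in P. q x \<noteq> \<infinity>" by (intro nn_integral_PInf_AE) auto
  define r where "r x = enn2real (q x)" for x
  have [measurable]: "r \<in> borel_measurable borel" unfolding r_def by measurable
  have r0: "0 \<le> r x" for x by (simp add: r_def)
  have qr: "AE x in P. q x = ennreal (r x)"
    using q_fin by eventually_elim (simp add: r_def less_top)
  let ?Q = "density P r"
  have Qq: "?Q = density P q"
    using qr by (intro density_cong) (auto elim: eventually_mono)
  \<comment> \<open>Integrals against the new law are averages of conditional expectations, which is
    how constraints on sums become constraints on a single law.\<close>
  have Q_int: "(\<integral>\<^sup>+ x. g x \<partial>?Q) = (\<Sum>i=1..n. \<integral>\<^sup>+ \<omega>. g (X i \<omega>) \<partial>V) / of_nat n"
    if [measurable]: "g \<in> borel_measurable borel" for g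
    unfolding Qq using q_int[OF that] by (subst nn_integral_density) auto
  interpret Q: prob_space ?Q
    by standard (use Q_int[of "\<lambda>_. 1"] in \<open>simp add: V.emeasure_space_1[simplified] n1\<close>)
  have integrable_Q: "integrable ?Q g \<longleftrightarrow> (\<forall>i\<in>{1..n}. integrable V (\<lambda>\<omega>. g (X i \<omega>)))"
    if [measurable]: "g \<in> borel_measurable borel" for g :: "real \<Rightarrow> real"
    using n by (simp add: integrable_iff_bounded Q_int ennreal_divide_eq_top_iff n' less_top[symmetric])
  have integral_nonneg_Q: "(\<integral>x. g x \<partial>?Q) = (\<Sum>i=1..n. V.expectation (\<lambda>\<omega>. g (X i \<omega>))) / n"
    if [measurable]: "g \<in> borel_measurable borel" and g: "integrable ?Q g" and g0: "\<And>x. 0 \<le> g x" for g :: "real \<Rightarrow> real"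
  proof -
    have gV: "i \<in> {1..n} \<Longrightarrow> integrable V (\<lambda>\<omega>. g (X i \<omega>))" for i using g by (simp add: integrable_Q)
    have "ennreal (\<integral>x. g x \<partial>?Q) = (\<integral>\<^sup>+ x. g x \<partial>?Q)"
      using g g0 by (simp add: nn_integral_eq_integral)
    also have "\<dots> = (\<Sum>i=1..n. \<integral>\<^sup>+ \<omega>. g (X i \<omega>) \<partial>V) / of_nat n" by (subst Q_int) auto
    also have "(\<Sum>i=1..n. \<integral>\<^sup>+ \<omega>. g (X i \<omega>) \<partial>V) = (\<Sum>i=1..n. ennreal (V.expectation (\<lambda>\<omega>. g (X i \<omega>))))"
      using gV g0 by (intro sum.cong refl nn_integral_eq_integral) auto
    also have "\<dots> = ennreal (\<Sum>i=1..n. V.expectation (\<lambda>\<omega>. g (X i \<omega>)))"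
      using g0 by (intro sum_ennreal) (auto intro: integral_nonneg)
    also have "\<dots> / of_nat n = ennreal ((\<Sum>i=1..n. V.expectation (\<lambda>\<omega>. g (X i \<omega>))) / n)"
      using n g0 by (subst ennreal_of_nat_eq_real_of_nat, subst divide_ennreal) (auto intro!: sum_nonneg integral_nonneg)
    finally show ?thesis
      using g0 by (subst (asm) ennreal_inj) (auto intro!: sum_nonneg integral_nonneg divide_nonneg_nonneg)
  qed
  have integral_Q: "(\<integral>x. g x \<partial>?Q) = (\<Sum>i=1..n. V.expectation (\<lambda>\<omega>. g (X i \<omega>))) / n"
    if [measurable]: "g \<in> borel_measurable borel" and g: "integrable ?Q g" for g :: "real \<Rightarrow> real"
  proof -
    have gV: "i \<in> {1..n} \<Longrightarrow> integrable V (\<lambda>\<omega>. g (X i \<omega>))" for i using g by (simp add: integrable_Q)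
    have "(\<integral>x. g x \<partial>?Q) = (\<integral>x. max (g x) 0 - max (- g x) 0 \<partial>?Q)"
      by (intro Bochner_Integration.integral_cong) auto
    also have "\<dots> = (\<integral>x. max (g x) 0 \<partial>?Q) - (\<integral>x. max (- g x) 0 \<partial>?Q)"
      using g by (intro Bochner_Integration.integral_diff integrable_max) auto
    also have "\<dots> = (\<Sum>i=1..n. V.expectation (\<lambda>\<omega>. max (g (X i \<omega>)) 0)) / n
        - (\<Sum>i=1..n. V.expectation (\<lambda>\<omega>. max (- g (X i \<omega>)) 0)) / n"
      using g by (intro arg_cong2[where f = "(-)"] integral_nonneg_Q integrable_max) auto
    also have "\<dots> = (\<Sum>i=1..n. V.expectation (\<lambda>\<omega>. max (g (X i \<omega>)) 0) - V.expectation (\<lambda>\<omega>. max (- g (X i \<omega>)) 0)) / n"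
      by (simp only: sum_subtractf diff_divide_distrib)
    also have "(\<Sum>i=1..n. V.expectation (\<lambda>\<omega>. max (g (X i \<omega>)) 0) - V.expectation (\<lambda>\<omega>. max (- g (X i \<omega>)) 0))
        = (\<Sum>i=1..n. V.expectation (\<lambda>\<omega>. g (X i \<omega>)))"
    proof (intro sum.cong refl)
      fix i assume "i \<in> {1..n}"
      then have "V.expectation (\<lambda>\<omega>. max (g (X i \<omega>)) 0) - V.expectation (\<lambda>\<omega>. max (- g (X i \<omega>)) 0)
         = V.expectation (\<lambda>\<omega>. max (g (X i \<omega>)) 0 - max (- g (X i \<omega>)) 0)"
        using gV by (intro Bochner_Integration.integral_diff[symmetric] integrable_max) auto
      also have "\<dots> = V.expectation (\<lambda>\<omega>. g (X i \<omega>))"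
        by (intro Bochner_Integration.integral_cong) auto
      finally show "V.expectation (\<lambda>\<omega>. max (g (X i \<omega>)) 0) - V.expectation (\<lambda>\<omega>. max (- g (X i \<omega>)) 0)
         = V.expectation (\<lambda>\<omega>. g (X i \<omega>))" .
    qed
    finally show ?thesis .
  qed
  have int_PQ: "integrable ?Q g" if [measurable]: "g \<in> borel_measurable borel" and g: "integrable P g" for g :: "real \<Rightarrow> real"
    unfolding integrable_Q[OF that(1)]
  proof
    fix i
    have "(\<integral>\<^sup>+ \<omega>. ennreal (norm (g (X i \<omega>))) \<partial>V) \<le> ennreal (1 / prob A) * (\<integral>\<^sup>+ \<omega>. ennreal (norm (g (X i \<omega>))) \<partial>M)"
      by (intro V_le) auto
    also have "(\<integral>\<^sup>+ \<omega>. ennreal (norm (g (X i \<omega>))) \<partial>M) = (\<integral>\<^sup>+ x. ennreal (norm (g x)) \<partial>P)"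
      by (rule nn_integral_X[of "\<lambda>x. ennreal (norm (g x))"]) auto
    also have "ennreal (1 / prob A) * \<dots> < \<infinity>"
      using g by (auto simp: integrable_iff_bounded ennreal_mult_less_top)
    finally show "integrable V (\<lambda>\<omega>. g (X i \<omega>))"
      by (intro integrableI_bounded) auto
  qed
  have r1: "(\<integral>\<^sup>+ x. ennreal (r x) \<partial>P) = 1"
    using Q.emeasure_space_1 by (simp add: emeasure_density)
  \<comment> \<open>The positive part is handled by \<open>ln (r x) \<le> r x\<close>: under
    \<open>P\<close> the right side has integral 1, and conditioning costs a finite factor.\<close>
  have ln_r: "integrable ?Q (\<lambda>x. ln (r x))"
  proof -
    have "(\<integral>\<^sup>+ \<omega>. ennreal (ln (r (X i \<omega>))) \<partial>V) < \<infinity>" for i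
    proof -
      have "(\<integral>\<^sup>+ \<omega>. ennreal (ln (r (X i \<omega>))) \<partial>V) \<le> ennreal (1 / prob A) * (\<integral>\<^sup>+ \<omega>. ennreal (ln (r (X i \<omega>))) \<partial>M)"
        by (intro V_le) auto
      also have "(\<integral>\<^sup>+ \<omega>. ennreal (ln (r (X i \<omega>))) \<partial>M) = (\<integral>\<^sup>+ x. ennreal (ln (r x)) \<partial>P)"
        by (rule nn_integral_X[of "\<lambda>x. ennreal (ln (r x))"]) auto
      also have "\<dots> \<le> (\<integral>\<^sup>+ x. ennreal (r x) \<partial>P)"
      proof (intro nn_integral_mono ennreal_leI)
        fix x show "ln (r x) \<le> r x" using r0[of x] ln_le_minus_one[of "r x"] by (cases "r x = 0") auto
      qed
      also note r1
      finally show ?thesis by (rule order_le_less_trans) (auto simp: mult_left_mono)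
    qed
    then have "(\<integral>\<^sup>+ x. ennreal (ln (r x)) \<partial>?Q) \<noteq> \<infinity>"
      using n by (simp add: Q_int ennreal_divide_eq_top_iff n' less_top[symmetric])
    moreover have "(\<integral>\<^sup>+ x. ennreal (- ln (r x)) \<partial>?Q) \<noteq> \<infinity>"
      using nn_integral_neg_ln_density[OF prob_space_P, of r] by (auto simp: top_unique)
    ultimately show ?thesis by (auto simp: real_integrable_def)
  qed
  have AE_A: "AE \<omega> in V. \<omega> \<in> A"
    unfolding V_def by (rule AE_uniform_measureI) auto
  have intV: "i \<in> {1..n} \<Longrightarrow> integrable V (\<lambda>\<omega>. F (X i \<omega>))" "i \<in> {1..n} \<Longrightarrow> integrable V (\<lambda>\<omega>. U (X i \<omega>))"
    "i \<in> {1..n} \<Longrightarrow> integrable V (\<lambda>\<omega>. ln (r (X i \<omega>)))" for i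
    using int_PQ[OF _ F] int_PQ[OF _ U] ln_r by (auto simp: integrable_Q)
  \<comment> \<open>Strictness survives taking expectations because the inequality is strict almost
    surely. The sign is flipped to fit a lemma about upper bounds.\<close>
  have "V.expectation (\<lambda>\<omega>. - (\<Sum>i=1..n. F (X i \<omega>))) < - (real n * a)"
    using AE_A intV by (intro V.expectation_less) (auto simp: A_def)
  then have "real n * a < (\<Sum>i=1..n. V.expectation (\<lambda>\<omega>. F (X i \<omega>)))"
    using intV by (simp add: Bochner_Integration.integral_sum)
  then have a: "a < (\<integral>x. F x \<partial>?Q)"
    using n int_PQ[OF _ F] by (simp add: integral_Q pos_less_divide_eq mult.commute)
  have "V.expectation (\<lambda>\<omega>. \<Sum>i=1..n. U (X i \<omega>)) < real n * b"
    using AE_A intV by (intro V.expectation_less) (auto simp: A_def)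
  then have "(\<Sum>i=1..n. V.expectation (\<lambda>\<omega>. U (X i \<omega>))) < real n * b"
    using intV by (simp add: Bochner_Integration.integral_sum)
  then have b: "(\<integral>x. U x \<partial>?Q) < b"
    using n int_PQ[OF _ U] by (simp add: integral_Q pos_divide_less_eq mult.commute)
  \<comment> \<open>The zero set of \<open>r\<close> is null for the averaged law. An average of
    nonnegative terms vanishes only if each term does, so every \<open>X i\<close> with
    \<open>i\<close> in the range avoids that set.\<close>
  have pos: "AE \<omega> in V. \<forall>i\<in>{1..n}. 0 < r (X i \<omega>)"
  proof (subst AE_finite_all, simp, intro ballI)
    fix i assume i: "i \<in> {1..n}"
    have "(\<integral>\<^sup>+ x. indicator {x. r x = 0} x \<partial>?Q) = (\<integral>\<^sup>+ x. ennreal (r x) * indicator {x. r x = 0} x \<partial>P)"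
      by (subst nn_integral_density) auto
    also have "\<dots> = (\<integral>\<^sup>+ x. 0 \<partial>P)" by (intro nn_integral_cong) (auto simp: indicator_def)
    finally have "(\<Sum>i=1..n. \<integral>\<^sup>+ \<omega>. indicator {x. r x = 0} (X i \<omega>) \<partial>V) / of_nat n = 0"
      by (subst (asm) Q_int) auto
    then have "(\<integral>\<^sup>+ \<omega>. indicator {x. r x = 0} (X i \<omega>) \<partial>V) = 0"
      using i n' by (auto simp: ennreal_divide_eq_0_iff)
    then have "AE \<omega> in V. indicator {x. r x = 0} (X i \<omega>) = (0 :: ennreal)"
      by (subst (asm) nn_integral_0_iff_AE) auto
    then show "AE \<omega> in V. 0 < r (X i \<omega>)"
      by eventually_elim (use r0 in \<open>auto simp: indicator_def less_le split: if_splits\<close>)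
  qed
  \<comment> \<open>The summand \<open>ln (prob A)\<close> compensates the factor
    \<open>1 / prob A\<close> from conditioning, so that the exponential mean is at most 1 and
    Jensen applies.\<close>
  have "(\<integral>\<^sup>+ \<omega>. ennreal (exp ((\<Sum>i=1..n. ln (r (X i \<omega>))) + ln (prob A))) \<partial>V)
      = (\<integral>\<^sup>+ \<omega>. ennreal (prob A) * (\<Prod>i=1..n. ennreal (r (X i \<omega>))) \<partial>V)"
  proof (intro nn_integral_cong_AE)
    show "AE \<omega> in V. ennreal (exp ((\<Sum>i=1..n. ln (r (X i \<omega>))) + ln (prob A)))
        = ennreal (prob A) * (\<Prod>i=1..n. ennreal (r (X i \<omega>)))"
      using pos
    proof eventually_elim
      case (elim \<omega>)
      then have "exp (\<Sum>i=1..n. ln (r (X i \<omega>))) = (\<Prod>i=1..n. r (X i \<omega>))"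
        by (simp add: exp_sum)
      then show ?case
        using p r0 by (simp add: exp_add prod_ennreal prod_nonneg mult.commute flip: ennreal_mult)
    qed
  qed
  also have "\<dots> \<le> ennreal (1 / prob A) * (\<integral>\<^sup>+ \<omega>. ennreal (prob A) * (\<Prod>i=1..n. ennreal (r (X i \<omega>))) \<partial>M)"
    by (intro V_le) measurable
  also have "(\<integral>\<^sup>+ \<omega>. ennreal (prob A) * (\<Prod>i=1..n. ennreal (r (X i \<omega>))) \<partial>M)
      = ennreal (prob A) * (\<integral>\<^sup>+ \<omega>. (\<Prod>i=1..n. ennreal (r (X i \<omega>))) \<partial>M)"
    by (rule nn_integral_cmult) measurable
  also have "(\<integral>\<^sup>+ \<omega>. (\<Prod>i=1..n. ennreal (r (X i \<omega>))) \<partial>M) = 1"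
    using nn_integral_prod_X[of "\<lambda>x. ennreal (r x)" n] r1 by simp
  also have "ennreal (1 / prob A) * (ennreal (prob A) * 1) = 1"
    using p by (simp flip: ennreal_mult)
  finally have "V.expectation (\<lambda>\<omega>. (\<Sum>i=1..n. ln (r (X i \<omega>))) + ln (prob A)) \<le> 0"
    using intV(3) by (intro V.expectation_nonpos_if_exp Bochner_Integration.integrable_add
        Bochner_Integration.integrable_sum) auto
  also have "V.expectation (\<lambda>\<omega>. (\<Sum>i=1..n. ln (r (X i \<omega>))) + ln (prob A))
      = V.expectation (\<lambda>\<omega>. \<Sum>i=1..n. ln (r (X i \<omega>))) + V.expectation (\<lambda>_. ln (prob A))"
    by (intro Bochner_Integration.integral_add Bochner_Integration.integrable_sum intV(3)) auto
  also have "V.expectation (\<lambda>\<omega>. \<Sum>i=1..n. ln (r (X i \<omega>))) = (\<Sum>i=1..n. V.expectation (\<lambda>\<omega>. ln (r (X i \<omega>))))"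
    by (rule Bochner_Integration.integral_sum) (rule intV(3))
  also have "V.expectation (\<lambda>_. ln (prob A)) = ln (prob A)"
    using V.prob_space by simp
  finally have "(\<Sum>i=1..n. V.expectation (\<lambda>\<omega>. ln (r (X i \<omega>)))) \<le> - ln (prob A)"
    by simp
  then have "real n * (\<integral>x. ln (r x) \<partial>?Q) \<le> - ln (prob A)"
    using n ln_r by (simp add: integral_Q)
  then show ?thesis
    using r0 a b ln_r int_PQ[OF _ F] int_PQ[OF _ U] Q.prob_space_axioms by (intro exI[of _ r]) auto
qed

end

section \<open>Heavy tails make mean shifts cheap\<close>

text \<open>Otherwise the tail would eventually decay like \<open>exp (- \<theta> * real k)\<close>,
  and the exponential moment at \<open>\<theta> / 2\<close> would be finite; halving the exponent
  leaves a geometric series.\<close>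

lemma (in prob_space) heavy_tail:
  fixes F :: "'a \<Rightarrow> real"
  assumes [measurable]: "F \<in> borel_measurable M" and F0: "\<And>x. 0 \<le> F x"
    and inf: "\<And>\<theta>. 0 < \<theta> \<Longrightarrow> (\<integral>\<^sup>+ x. ennreal (exp (\<theta> * F x)) \<partial>M) = \<infinity>" and \<theta>: "0 < \<theta>"
  shows "\<exists>k\<ge>N. exp (- \<theta> * real k) \<le> prob {x \<in> space M. real k \<le> F x}"
proof (rule ccontr)
  define A where "A k = {x \<in> space M. real k \<le> F x}" for k :: nat
  have [measurable]: "A k \<in> sets M" for k unfolding A_def by measurable
  \<comment> \<open>Bounds the contribution of the slab between \<open>k\<close> and
    \<open>k + 1\<close>: the exponential is taken at the upper edge, the mass is that of the whole
    tail.\<close>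
  define f where "f k = exp (\<theta> / 2 * (real k + 1)) * prob (A k)" for k
  assume "\<not> ?thesis"
  then have small: "prob (A k) \<le> exp (- \<theta> * real k)" if "k \<ge> N" for k
    using that unfolding A_def by (meson less_eq_real_def not_le)
  have f0: "0 \<le> f k" for k by (simp add: f_def)
  have "summable f"
  proof (rule summable_comparison_test')
    show "summable (\<lambda>k. exp (\<theta> / 2) * exp (- (\<theta> / 2)) ^ k)"
      using \<theta> by (intro summable_mult summable_geometric) auto
    fix k assume "k \<ge> N"
    have "f k \<le> exp (\<theta> / 2 * (real k + 1)) * exp (- \<theta> * real k)"
      unfolding f_def by (intro mult_left_mono small \<open>k \<ge> N\<close>) auto
    also have "\<dots> = exp (\<theta> / 2 + real k * (- (\<theta> / 2)))"
      unfolding exp_add[symmetric] by (rule arg_cong[where f = exp]) (simp add: field_simps)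
    also have "\<dots> = exp (\<theta> / 2) * exp (- (\<theta> / 2)) ^ k"
      by (simp only: exp_add exp_of_nat_mult)
    finally show "norm (f k) \<le> exp (\<theta> / 2) * exp (- (\<theta> / 2)) ^ k"
      by (simp add: f_def)
  qed
  have "(\<integral>\<^sup>+ x. ennreal (exp (\<theta> / 2 * F x)) \<partial>M)
      \<le> (\<integral>\<^sup>+ x. (\<Sum>k. ennreal (exp (\<theta> / 2 * (real k + 1))) * indicator (A k) x) \<partial>M)"
  proof (intro nn_integral_mono)
    fix x assume x: "x \<in> space M"
    define k where "k = nat \<lfloor>F x\<rfloor>"
    have k: "real k \<le> F x" "F x \<le> real k + 1"
      using F0[of x] unfolding k_def by linarith+
    have "exp (\<theta> / 2 * F x) \<le> exp (\<theta> / 2 * (real k + 1))" using k \<theta> by simp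
    then have "ennreal (exp (\<theta> / 2 * F x)) \<le> ennreal (exp (\<theta> / 2 * (real k + 1))) * indicator (A k) x"
      using k x by (simp add: A_def)
    also have "\<dots> = (\<Sum>j\<in>{k}. ennreal (exp (\<theta> / 2 * (real j + 1))) * indicator (A j) x)"
      by (subst sum.insert) auto
    also have "\<dots> \<le> (\<Sum>k. ennreal (exp (\<theta> / 2 * (real k + 1))) * indicator (A k) x)"
      by (intro sum_le_suminf) auto
    finally show "ennreal (exp (\<theta> / 2 * F x)) \<le> (\<Sum>k. ennreal (exp (\<theta> / 2 * (real k + 1))) * indicator (A k) x)" .
  qed
  also have "\<dots> = (\<Sum>k. \<integral>\<^sup>+ x. ennreal (exp (\<theta> / 2 * (real k + 1))) * indicator (A k) x \<partial>M)"
    by (rule nn_integral_suminf) measurable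
  also have "\<dots> = (\<Sum>k. ennreal (f k))"
    by (simp add: nn_integral_cmult_indicator emeasure_eq_measure f_def ennreal_mult)
  also have "\<dots> = ennreal (suminf f)"
    using \<open>summable f\<close> f0 by (rule suminf_ennreal2[rotated])
  finally show False using inf[of "\<theta> / 2"] \<theta> by (simp add: top_unique)
qed

text \<open>Moving mass \<open>c / k\<close> onto \<open>{F \<ge> k}\<close> raises the mean of \<open>F\<close> by about \<open>c\<close>, and by
  \<open>heavy_tail\<close> it costs an entropy of at most about \<open>(c / k) (\<theta> k)\<close>.\<close>

lemma (in prob_space) cheap_mean_shift:
  fixes F :: "'a \<Rightarrow> real"
  assumes F: "integrable M F" and F0: "\<And>x. 0 \<le> F x"
    and inf: "\<And>\<theta>. 0 < \<theta> \<Longrightarrow> (\<integral>\<^sup>+ x. ennreal (exp (\<theta> * F x)) \<partial>M) = \<infinity>"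
    and \<epsilon>: "0 < \<epsilon>" and \<eta>: "0 < \<eta>"
  shows "\<exists>r :: 'a \<Rightarrow> real. r \<in> borel_measurable M \<and> (\<forall>x. 0 \<le> r x) \<and> prob_space (density M r) \<and>
    integrable (density M r) F \<and> integrable (density M r) (\<lambda>x. ln (r x)) \<and>
    expectation F + \<epsilon> < (\<integral>x. F x \<partial>density M r) \<and> (\<integral>x. ln (r x) \<partial>density M r) < \<eta>"
proof -
  have [measurable]: "F \<in> borel_measurable M" using F by auto
  define \<mu> where "\<mu> = expectation F"
  have \<mu>: "0 \<le> \<mu>" by (simp add: \<mu>_def F0)
  \<comment> \<open>The surplus 1 over \<open>\<epsilon>\<close> pays for the loss
    \<open>\<delta> * \<mu>\<close> caused by scaling \<open>P\<close> down; the lower bound on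
    \<open>k\<close> makes both \<open>\<delta>\<close> and \<open>\<delta> * \<mu>\<close> smaller
    than 1. The choice of \<open>\<theta>\<close> anticipates the final entropy bound
    \<open>\<theta> * (\<mu> + c)\<close>.\<close>
  define c where "c = \<epsilon> + 1"
  have c: "c > 0" using \<epsilon> by (simp add: c_def)
  define \<theta> where "\<theta> = \<eta> / (c + \<mu> + 1)"
  have \<theta>: "\<theta> > 0" using \<eta> \<mu> c by (simp add: \<theta>_def)
  obtain k where k: "k \<ge> nat \<lceil>c * (1 + \<mu>)\<rceil> + 1" and
    tail: "exp (- \<theta> * real k) \<le> prob {x \<in> space M. real k \<le> F x}"
    using heavy_tail[OF _ F0 inf \<theta>, of "nat \<lceil>c * (1 + \<mu>)\<rceil> + 1"] by auto
  have kc: "c * (1 + \<mu>) < real k" using k by linarith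
  have "0 \<le> c * \<mu>" using c \<mu> by simp
  then have kc1: "c < real k" "c * \<mu> < real k" "real k > 0"
    using kc c unfolding distrib_left mult_1_right by linarith+
  define A where "A = {x \<in> space M. real k \<le> F x}"
  have A[measurable]: "A \<in> sets M" unfolding A_def by measurable
  define p where "p = prob A"
  have p_exp: "exp (- \<theta> * real k) \<le> p" using tail by (simp add: p_def A_def)
  have p: "0 < p" using p_exp by (rule less_le_trans[OF exp_gt_zero])
  have p1: "p \<le> 1" by (simp add: p_def)
  define \<delta> where "\<delta> = c / real k"
  have \<delta>: "0 < \<delta>" "\<delta> < 1" using c kc1 by (auto simp: \<delta>_def)
  have \<delta>k: "\<delta> * real k = c" using kc1 by (simp add: \<delta>_def)
  \<comment> \<open>The mixture of \<open>M\<close>, with weight \<open>1 - \<delta>\<close>, and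
    \<open>M\<close> conditioned on \<open>A\<close>, with weight \<open>\<delta>\<close>.\<close>
  define r where "r x = (1 - \<delta>) + \<delta> / p * indicator A x" for x
  have r[measurable]: "r \<in> borel_measurable M" unfolding r_def by measurable
  have r0: "0 < r x" for x unfolding r_def using \<delta> p by (intro add_pos_nonneg) auto
  have r_int: "integrable M r" unfolding r_def by (auto simp: emeasure_eq_measure)
  have "expectation r = (1 - \<delta>) + \<delta> / p * p"
    unfolding r_def by (subst Bochner_Integration.integral_add) (auto simp: emeasure_eq_measure p_def prob_space)
  then have "expectation r = 1" using p by simp
  then have "(\<integral>\<^sup>+ x. ennreal (r x) \<partial>M) = 1"
    using r_int r0 by (subst nn_integral_eq_integral) (auto simp: less_imp_le)
  then have Q: "prob_space (density M r)"
    by (intro prob_spaceI) (simp add: emeasure_density cong: nn_integral_cong)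
  have FA: "integrable M (\<lambda>x. indicator A x * F x)"
    using integrable_mult_indicator[OF A F] by simp
  have rF: "r x * F x = (1 - \<delta>) * F x + \<delta> / p * (indicator A x * F x)" for x
    by (simp add: r_def distrib_right)
  have F_int: "integrable (density M r) F"
    using r0 F FA by (subst integrable_density) (auto simp: less_imp_le rF)
  \<comment> \<open>Markov's inequality, used on both sides: the middle term enters the new mean of
    \<open>F\<close>, the bound by \<open>\<mu>\<close> enters the entropy.\<close>
  have "real k * p = expectation (\<lambda>x. indicator A x * real k)"
    by (simp add: p_def)
  also have "\<dots> \<le> expectation (\<lambda>x. indicator A x * F x)"
  proof (intro integral_mono FA)
    show "integrable M (\<lambda>x. indicator A x * real k)" by (auto simp: emeasure_eq_measure)
  qed (auto simp: indicator_def A_def)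
  finally have kp: "real k * p \<le> expectation (\<lambda>x. indicator A x * F x)" .
  also have "\<dots> \<le> \<mu>"
    unfolding \<mu>_def by (intro integral_mono F FA) (auto simp: indicator_def F0)
  finally have kp\<mu>: "real k * p \<le> \<mu>" .
  have "\<mu> + \<epsilon> < (1 - \<delta>) * \<mu> + \<delta> * real k"
    unfolding \<delta>k using kc1 by (simp add: c_def \<delta>_def field_simps)
  also have "\<dots> = (1 - \<delta>) * \<mu> + \<delta> / p * (real k * p)" using p by simp
  also have "\<dots> \<le> (1 - \<delta>) * \<mu> + \<delta> / p * expectation (\<lambda>x. indicator A x * F x)"
    using \<delta> p by (intro add_left_mono mult_left_mono kp) auto
  also have "\<dots> = (\<integral>x. F x \<partial>density M r)"
    using r0 F FA by (subst integral_density) (auto simp: less_imp_le rF \<mu>_def)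
  finally have mean: "\<mu> + \<epsilon> < (\<integral>x. F x \<partial>density M r)" .
  \<comment> \<open>The value of \<open>r\<close> on \<open>A\<close>, at most \<open>1 / p\<close>;
    by the tail bound its logarithm is therefore at most \<open>\<theta> * real k\<close>. Off
    \<open>A\<close> the density is below 1 and contributes nothing positive.\<close>
  define w where "w = 1 - \<delta> + \<delta> / p"
  have w: "0 < w" using \<delta> p by (simp add: w_def add_pos_nonneg)
  have "(1 - \<delta>) * 1 \<le> (1 - \<delta>) * (1 / p)" using \<delta> p p1 by (intro mult_left_mono) auto
  then have "w \<le> 1 / p" by (simp add: w_def left_diff_distrib diff_divide_distrib)
  then have lnw: "ln w \<le> - ln p" using ln_mono[of w "1 / p"] w p by (simp add: ln_div)
  have lnp: "- ln p \<le> \<theta> * real k"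
    using ln_mono[OF p_exp exp_gt_zero] by simp
  have rln: "r x * ln (r x) = (1 - \<delta>) * ln (1 - \<delta>) + (w * ln w - (1 - \<delta>) * ln (1 - \<delta>)) * indicator A x" for x
    by (auto simp: r_def w_def indicator_def)
  have rln_int: "integrable M (\<lambda>x. r x * ln (r x))"
    unfolding rln by (auto simp: emeasure_eq_measure)
  have ln_int: "integrable (density M r) (\<lambda>x. ln (r x))"
    using r0 rln_int by (subst integrable_density) (auto simp: less_imp_le)
  have "(\<integral>x. ln (r x) \<partial>density M r) = expectation (\<lambda>x. r x * ln (r x))"
    using r0 by (subst integral_density) (auto simp: less_imp_le)
  also have "\<dots> \<le> expectation (\<lambda>x. w * (\<theta> * real k) * indicator A x)"
  proof (intro integral_mono rln_int)
    fix x
    have "(1 - \<delta>) * ln (1 - \<delta>) \<le> 0" using \<delta> by (intro mult_nonneg_nonpos) auto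
    moreover have "w * ln w \<le> w * (\<theta> * real k)" using w lnw lnp by (intro mult_left_mono) auto
    ultimately show "r x * ln (r x) \<le> w * (\<theta> * real k) * indicator A x"
      unfolding rln by (auto simp: indicator_def)
  qed (auto simp: emeasure_eq_measure)
  also have "\<dots> = w * (\<theta> * real k) * p" by (simp add: p_def)
  \<comment> \<open>Here \<open>\<delta> * real k\<close> equals \<open>c\<close> and
    \<open>real k * p\<close> is at most \<open>\<mu>\<close>, so the estimate no longer grows with
    \<open>k\<close>.\<close>
  also have "\<dots> = \<theta> * ((1 - \<delta>) * (real k * p) + \<delta> * real k)"
    using p by (simp add: w_def field_simps)
  also have "\<dots> \<le> \<theta> * (1 * \<mu> + c)"
    unfolding \<delta>k using \<theta> \<delta> p kp\<mu> by (intro mult_left_mono add_right_mono mult_mono) auto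
  also have "\<dots> < \<theta> * (c + \<mu> + 1)" using \<theta> by simp
  also have "\<dots> = \<eta>" using c \<mu> by (simp add: \<theta>_def)
  finally have "(\<integral>x. ln (r x) \<partial>density M r) < \<eta>" .
  then show ?thesis
    using r r0 Q F_int ln_int mean unfolding \<mu>_def by (intro exI[of _ r]) (auto simp: less_imp_le)
qed

section \<open>From probability bounds to the two rates\<close>

lemma ext_ln_ennreal: "0 < p \<Longrightarrow> ext_ln (ennreal p) = ereal (ln p)"
  by (simp add: ext_ln_def)

text \<open>Phrased to cover an infinite rate: then \<open>lower\<close> is vacuous, while
  \<open>upper\<close> forces \<open>p n = 0\<close> for positive \<open>n\<close>, and the
  logarithm is \<open>-\<infinity>\<close>.\<close>

lemma tendsto_log_rate:
  fixes p :: "nat \<Rightarrow> real" and I :: ereal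
  assumes p0: "\<And>n. 0 \<le> p n"
    and upper: "\<And>n. 0 < n \<Longrightarrow> 0 < p n \<Longrightarrow> I \<le> ereal (- ln (p n) / real n)"
    and lower: "\<And>h. I < ereal h \<Longrightarrow> \<forall>\<^sub>F n in sequentially. exp (- real n * h) \<le> p n"
  shows "(\<lambda>n. ereal (1 / real n) * ext_ln (ennreal (p n))) \<longlonglongrightarrow> - I"
proof (rule order_tendstoI)
  fix y assume "y < - I"
  then have "I < - y" by (simp add: ereal_less_uminus_reorder)
  then obtain h where h: "I < ereal h" "ereal h < - y" using ereal_dense2 by blast
  show "\<forall>\<^sub>F n in sequentially. y < ereal (1 / real n) * ext_ln (ennreal (p n))"
    using lower[OF h(1)] eventually_gt_at_top[of 0]
  proof eventually_elim
    case (elim n)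
    then have pn: "0 < p n" using less_le_trans[OF exp_gt_zero] by blast
    have "- real n * h \<le> ln (p n)" using elim pn by (simp add: ln_ge_iff)
    then have "- h \<le> ln (p n) / real n" using elim by (simp add: field_simps)
    then have "ereal (- h) \<le> ereal (1 / real n) * ext_ln (ennreal (p n))"
      using pn by (simp add: ext_ln_ennreal)
    moreover have "y < ereal (- h)" using h(2) by (simp add: ereal_less_uminus_reorder)
    ultimately show ?case by (rule less_le_trans[rotated])
  qed
next
  fix y assume y: "- I < y"
  show "\<forall>\<^sub>F n in sequentially. ereal (1 / real n) * ext_ln (ennreal (p n)) < y"
    using eventually_gt_at_top[of 0]
  proof eventually_elim
    case (elim n)
    have "ereal (1 / real n) * ext_ln (ennreal (p n)) \<le> - I"
    proof (cases "0 < p n")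
      case True
      then show ?thesis
        using upper[OF elim True] by (cases I) (auto simp: ext_ln_ennreal)
    next
      case False
      then have "p n = 0" using p0[of n] by simp
      then show ?thesis using elim by (simp add: ext_ln_def)
    qed
    then show ?case using y by (rule order_le_less_trans)
  qed
qed

lemma Sigma_set_iff_integrable:
  assumes "prob_space Q" "sets Q = sets borel" "integrable Q F"
  shows "Q \<in> Sigma_set F \<mu> \<epsilon> \<longleftrightarrow> \<mu> + \<epsilon> < (\<integral>x. F x \<partial>Q)"
  using assms by (auto simp: Sigma_set_def ext_integral_eq_integral ext_integral_exists_integrable)

lemma E_set_iff_integrable:
  assumes "prob_space Q" "sets Q = sets borel" "integrable Q F" "integrable Q U"
  shows "Q \<in> E_set F \<mu> \<epsilon> U \<nu> u \<longleftrightarrow> \<mu> + \<epsilon> < (\<integral>x. F x \<partial>Q) \<and> (\<integral>x. U x \<partial>Q) < \<nu> + u"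
  using assms
  by (auto simp: E_set_def Sigma_set_iff_integrable ext_integral_eq_integral ext_integral_exists_integrable)


context iid_process
begin

theorem deviation_rate:
  fixes F :: "real \<Rightarrow> real"
  assumes [measurable]: "F \<in> borel_measurable borel" and F0: "\<And>x. 0 \<le> F x" and F: "integrable P F"
    and inf: "\<And>\<theta>. 0 < \<theta> \<Longrightarrow> (\<integral>\<^sup>+ x. ennreal (exp (\<theta> * F x)) \<partial>P) = \<infinity>" and \<epsilon>: "0 < \<epsilon>"
  defines "\<mu> \<equiv> \<integral>x. F x \<partial>P"
  shows "(INF Q \<in> Sigma_set F \<mu> \<epsilon>. relative_entropy Q P) = 0"
    and "(\<lambda>n. ereal (1 / real n) * ext_ln (ennreal (prob {\<omega> \<in> space M. real n * (\<mu> + \<epsilon>) < (\<Sum>i=1..n. F (X i \<omega>))})))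
      \<longlonglongrightarrow> 0"
proof -
  interpret P: prob_space P by (rule prob_space_P)
  have tilt: "\<exists>r :: real \<Rightarrow> real. r \<in> borel_measurable borel \<and> (\<forall>x. 0 \<le> r x) \<and> prob_space (density P r) \<and>
    integrable (density P r) F \<and> integrable (density P r) (\<lambda>x. ln (r x)) \<and>
    \<mu> + \<epsilon> < (\<integral>x. F x \<partial>density P r) \<and> (\<integral>x. ln (r x) \<partial>density P r) < h" if "0 < h" for h
    using P.cheap_mean_shift[OF F F0 inf \<epsilon> that] unfolding \<mu>_def
    by (simp add: measurable_cong_sets[OF sets_P refl])
  show "(INF Q \<in> Sigma_set F \<mu> \<epsilon>. relative_entropy Q P) = 0"
  proof (rule antisym)
    show "0 \<le> (INF Q \<in> Sigma_set F \<mu> \<epsilon>. relative_entropy Q P)"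
      by (intro INF_greatest relative_entropy_nonneg prob_space_P) (simp add: Sigma_set_def)
    show "(INF Q \<in> Sigma_set F \<mu> \<epsilon>. relative_entropy Q P) \<le> 0"
    proof (rule ereal_le_epsilon2)
      fix h :: real assume "0 < h"
      from tilt[OF this] obtain r :: "real \<Rightarrow> real" where r: "r \<in> borel_measurable borel"
        "prob_space (density P r)" "integrable (density P r) F" "integrable (density P r) (\<lambda>x. ln (r x))"
        "\<mu> + \<epsilon> < (\<integral>x. F x \<partial>density P r)" "(\<integral>x. ln (r x) \<partial>density P r) < h"
        by blast
      have "(INF Q \<in> Sigma_set F \<mu> \<epsilon>. relative_entropy Q P) \<le> relative_entropy (density P r) P"
        using r by (intro INF_lower) (simp add: Sigma_set_iff_integrable)
      also have "\<dots> = ereal (\<integral>x. ln (r x) \<partial>density P r)"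
        using r by (intro relative_entropy_density_integrable P.sigma_finite_measure_axioms) auto
      also have "\<dots> \<le> 0 + ereal h" using r by simp
      finally show "(INF Q \<in> Sigma_set F \<mu> \<epsilon>. relative_entropy Q P) \<le> 0 + ereal h" .
    qed
  qed
  let ?p = "\<lambda>n. prob {\<omega> \<in> space M. real n * (\<mu> + \<epsilon>) < (\<Sum>i=1..n. F (X i \<omega>))}"
  have "(\<lambda>n. ereal (1 / real n) * ext_ln (ennreal (?p n))) \<longlonglongrightarrow> - 0"
  \<comment> \<open>For rate 0 the upper condition only says that the logarithm of a probability is
    nonpositive.\<close>
  proof (rule tendsto_log_rate)
    fix h :: real assume "(0::ereal) < ereal h"
    then have "0 < h" by simp
    from tilt[OF this] obtain r :: "real \<Rightarrow> real" where r: "r \<in> borel_measurable borel" "\<And>x. 0 \<le> r x"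
      "prob_space (density P r)" "integrable (density P r) F" "integrable (density P r) (\<lambda>x. ln (r x))"
      "\<mu> + \<epsilon> < (\<integral>x. F x \<partial>density P r)" "(\<integral>x. ln (r x) \<partial>density P r) < h"
      by blast
    \<comment> \<open>The joint bound with a trivial second constraint, which reads
      \<open>0 < real n\<close>.\<close>
    have "\<forall>\<^sub>F n in sequentially. exp (- real n * h) \<le> prob {\<omega> \<in> space M.
        real n * (\<mu> + \<epsilon>) < (\<Sum>i=1..n. F (X i \<omega>)) \<and> (\<Sum>i=1..n. 0) < real n * 1}"
      using r by (intro deviation_lower_bound[where U = "\<lambda>_. 0"]) auto
    then show "\<forall>\<^sub>F n in sequentially. exp (- real n * h) \<le> ?p n"
      using eventually_gt_at_top[of 0] by eventually_elim simp
  qed (auto simp: prob_le_1 intro: divide_nonpos_nonneg)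
  then show "(\<lambda>n. ereal (1 / real n) * ext_ln (ennreal (?p n))) \<longlonglongrightarrow> 0" by simp
qed

theorem joint_deviation_rate:
  fixes F U :: "real \<Rightarrow> real"
  assumes [measurable]: "F \<in> borel_measurable borel" "U \<in> borel_measurable borel" and F0: "\<And>x. 0 \<le> F x"
    and F: "integrable P F" and U: "integrable P U"
    and F2: "integrable P (\<lambda>x. (F x)\<^sup>2)" and U2: "integrable P (\<lambda>x. (U x)\<^sup>2)"
    and bdd: "\<And>\<beta>::real. 0 < \<beta> \<Longrightarrow> \<exists>m. AE x in P. F x - \<beta> * U x \<le> m"
    and \<epsilon>: "0 < \<epsilon>" and u: "0 < u"
  defines "\<mu> \<equiv> \<integral>x. F x \<partial>P" and "\<nu> \<equiv> \<integral>x. U x \<partial>P"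
  shows "0 < (INF Q \<in> E_set F \<mu> \<epsilon> U \<nu> u. relative_entropy Q P)"
    and "(\<lambda>n. ereal (1 / real n) * ext_ln (ennreal (prob {\<omega> \<in> space M.
        real n * (\<mu> + \<epsilon>) < (\<Sum>i=1..n. F (X i \<omega>)) \<and> (\<Sum>i=1..n. U (X i \<omega>)) < real n * (\<nu> + u)})))
      \<longlonglongrightarrow> - (INF Q \<in> E_set F \<mu> \<epsilon> U \<nu> u. relative_entropy Q P)"
proof -
  interpret P: prob_space P by (rule prob_space_P)
  let ?I = "INF Q \<in> E_set F \<mu> \<epsilon> U \<nu> u. relative_entropy Q P"
  \<comment> \<open>The case \<open>\<beta> = 1\<close> gives \<open>F x \<le> U x + m\<close>
    almost everywhere. As \<open>F\<close> is nonnegative, \<open>- U\<close> is bounded above by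
    \<open>m\<close>; the constraint on the mean of \<open>U\<close> then makes \<open>U\<close>
    integrable, and with it \<open>F\<close>.\<close>
  have finite_entropy: "\<exists>r :: real \<Rightarrow> real. r \<in> borel_measurable borel \<and> (\<forall>x. 0 \<le> r x) \<and> Q = density P r \<and>
      integrable Q F \<and> integrable Q U \<and> integrable Q (\<lambda>x. ln (r x)) \<and>
      \<mu> + \<epsilon> < (\<integral>x. F x \<partial>Q) \<and> (\<integral>x. U x \<partial>Q) < \<nu> + u \<and>
      relative_entropy Q P = ereal (\<integral>x. ln (r x) \<partial>Q)"
    if Q: "Q \<in> E_set F \<mu> \<epsilon> U \<nu> u" and fin: "relative_entropy Q P < \<infinity>" for Q
  proof -
    have Q': "prob_space Q" and [measurable_cong, simp]: "sets Q = sets borel"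
      using Q by (auto simp: E_set_def Sigma_set_def)
    interpret Q: prob_space Q by fact
    obtain r :: "real \<Rightarrow> real" where r: "r \<in> borel_measurable P" "\<And>x. 0 \<le> r x" "Q = density P r"
      "integrable Q (\<lambda>x. ln (r x))" "relative_entropy Q P = ereal (\<integral>x. ln (r x) \<partial>Q)"
      using finite_relative_entropyE[OF prob_space_P Q' fin] by blast
    obtain m where m: "AE x in P. F x - 1 * U x \<le> m" using bdd[of 1] by auto
    have mQ: "AE x in Q. F x - 1 * U x \<le> m"
      unfolding r(3) using r(1) m by (subst AE_density) auto
    have "(\<integral>\<^sup>+ x. ennreal (- U x) \<partial>Q) \<le> (\<integral>\<^sup>+ x. ennreal m \<partial>Q)"
    proof (rule nn_integral_mono_AE)
      show "AE x in Q. ennreal (- U x) \<le> ennreal m"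
        using mQ
      proof eventually_elim
        case (elim x)
        then show ?case using F0[of x] by (intro ennreal_leI) simp
      qed
    qed
    also have "\<dots> < \<infinity>" by (simp add: Q.emeasure_space_1)
    finally have U_neg: "(\<integral>\<^sup>+ x. ennreal (- U x) \<partial>Q) < \<infinity>" .
    have "ext_integral Q (\<lambda>x. ereal (U x)) - ereal \<nu> < ereal u" using Q by (simp add: E_set_def)
    then have "ext_integral Q (\<lambda>x. ereal (U x)) < \<infinity>"
      by (cases "ext_integral Q (\<lambda>x. ereal (U x))") auto
    with U_neg have U_int: "integrable Q U"
      by (intro integrable_of_ext_integral_less_PInf) auto
    have F_int: "integrable Q F"
    proof (rule Bochner_Integration.integrable_bound)
      show "integrable Q (\<lambda>x. U x + m)" using U_int by simp
      show "AE x in Q. norm (F x) \<le> norm (U x + m)"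
        using mQ
      proof eventually_elim
        case (elim x) then show ?case using F0[of x] by simp
      qed
    qed auto
    show ?thesis
      using r Q F_int U_int E_set_iff_integrable[OF Q' _ F_int U_int, of \<mu> \<epsilon> \<nu> u]
      by (intro exI[of _ r]) auto
  qed
  have E_I: "?I \<le> ereal (\<integral>x. ln (r x) \<partial>density P r)"
    if "r \<in> borel_measurable borel" "prob_space (density P r)"
      "integrable (density P r) F" "integrable (density P r) U" "integrable (density P r) (\<lambda>x. ln (r x))"
      "\<mu> + \<epsilon> < (\<integral>x. F x \<partial>density P r)" "(\<integral>x. U x \<partial>density P r) < \<nu> + u" for r :: "real \<Rightarrow> real"
  proof -
    have "?I \<le> relative_entropy (density P r) P"
      using that by (intro INF_lower) (simp add: E_set_iff_integrable)
    also have "\<dots> = ereal (\<integral>x. ln (r x) \<partial>density P r)"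
      using that by (intro relative_entropy_density_integrable P.sigma_finite_measure_axioms) auto
    finally show ?thesis .
  qed
  show "0 < ?I"
  proof -
    \<comment> \<open>With this slope, relaxing the mean of \<open>U\<close> by \<open>u\<close>
      uses up only half of \<open>\<epsilon>\<close>. Laws in the set thus have mean of
      \<open>G\<close> above the \<open>P\<close>-mean plus \<open>\<epsilon> / 2\<close>, and
      \<open>c\<close> is placed a quarter of \<open>\<epsilon>\<close> above the
      \<open>P\<close>-mean, leaving room on both sides.\<close>
    define \<beta> where "\<beta> = \<epsilon> / (2 * u)"
    have \<beta>: "0 < \<beta>" and \<beta>u: "\<beta> * u = \<epsilon> / 2" using \<epsilon> u by (auto simp: \<beta>_def)
    define G where "G x = F x - \<beta> * U x" for x
    have [measurable]: "G \<in> borel_measurable borel" unfolding G_def by measurable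
    obtain m where m: "AE x in P. G x \<le> m" using bdd[OF \<beta>] unfolding G_def by blast
    have G_int: "integrable P G" unfolding G_def using F U by simp
    have G2: "integrable P (\<lambda>x. (G x)\<^sup>2)"
    proof (rule Bochner_Integration.integrable_bound)
      show "integrable P (\<lambda>x. 2 * (F x)\<^sup>2 + 2 * \<beta>\<^sup>2 * (U x)\<^sup>2)" using F2 U2 by simp
      have "(F x - \<beta> * U x)\<^sup>2 \<le> 2 * (F x)\<^sup>2 + 2 * \<beta>\<^sup>2 * (U x)\<^sup>2" for x
        using zero_le_power2[of "F x + \<beta> * U x"] by (simp add: power2_eq_square algebra_simps)
      then show "AE x in P. norm ((G x)\<^sup>2) \<le> norm (2 * (F x)\<^sup>2 + 2 * \<beta>\<^sup>2 * (U x)\<^sup>2)"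
        by (simp add: G_def)
    qed auto
    define c where "c = \<mu> - \<beta> * \<nu> + \<epsilon> / 4"
    have "P.expectation G < c"
      unfolding G_def using F U \<epsilon> by (simp add: c_def \<mu>_def \<nu>_def)
    with P.exp_moment_less_one[OF G_int G2 m] obtain \<theta> s where \<theta>: "\<theta> > 0" and s: "s > 0"
      and le: "(\<integral>\<^sup>+ x. ennreal (exp (\<theta> * (G x - c))) \<partial>P) \<le> ennreal (exp (- s))"
      by blast
    have "ereal s \<le> relative_entropy Q P" if Q: "Q \<in> E_set F \<mu> \<epsilon> U \<nu> u" for Q
    proof (cases "relative_entropy Q P < \<infinity>")
      case True
      from finite_entropy[OF Q True] obtain r where r: "r \<in> borel_measurable borel" "Q = density P r"
        "integrable Q F" "integrable Q U" "integrable Q (\<lambda>x. ln (r x))"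
        "\<mu> + \<epsilon> < (\<integral>x. F x \<partial>Q)" "(\<integral>x. U x \<partial>Q) < \<nu> + u" "relative_entropy Q P = ereal (\<integral>x. ln (r x) \<partial>Q)"
        by blast
      have Q': "prob_space Q" using Q by (simp add: E_set_def Sigma_set_def)
      interpret Q: prob_space Q by fact
      have "\<beta> * (\<integral>x. U x \<partial>Q) \<le> \<beta> * (\<nu> + u)" using r \<beta> by simp
      then have "c \<le> (\<integral>x. G x \<partial>Q)"
        unfolding G_def c_def using r \<beta>u \<epsilon> by (simp add: distrib_left)
      have "integrable Q G" unfolding G_def using r by simp
      then have "(\<integral>x. \<theta> * (G x - c) \<partial>Q) = \<theta> * ((\<integral>x. G x \<partial>Q) - c)"
        by (simp add: Q.prob_space)
      then have "0 \<le> (\<integral>x. \<theta> * (G x - c) \<partial>Q)"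
        using \<theta> \<open>c \<le> (\<integral>x. G x \<partial>Q)\<close> by simp
      moreover have "integrable Q (\<lambda>x. \<theta> * (G x - c))" using \<open>integrable Q G\<close> by simp
      then have "(\<integral>x. \<theta> * (G x - c) \<partial>Q) + s \<le> (\<integral>x. ln (r x) \<partial>Q)"
        using r Q' le unfolding r(2) by (intro integral_le_integral_ln_density) simp_all
      ultimately show ?thesis unfolding r(8) by simp
    qed auto
    then have "ereal s \<le> ?I" by (intro INF_greatest)
    then show ?thesis using s by (metis ereal_less(2) less_le_trans)
  qed
  let ?A = "\<lambda>n. {\<omega> \<in> space M. real n * (\<mu> + \<epsilon>) < (\<Sum>i=1..n. F (X i \<omega>)) \<and> (\<Sum>i=1..n. U (X i \<omega>)) < real n * (\<nu> + u)}"
  show "(\<lambda>n. ereal (1 / real n) * ext_ln (ennreal (prob (?A n)))) \<longlonglongrightarrow> - ?I"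
  proof (rule tendsto_log_rate)
    fix n assume n: "0 < n" and p: "0 < prob (?A n)"
    from deviation_upper_bound[OF assms(1,2) F U n p] obtain r :: "real \<Rightarrow> real" where
      r: "r \<in> borel_measurable borel" "prob_space (density P r)"
      "integrable (density P r) F" "integrable (density P r) U" "integrable (density P r) (\<lambda>x. ln (r x))"
      "\<mu> + \<epsilon> < (\<integral>x. F x \<partial>density P r)" "(\<integral>x. U x \<partial>density P r) < \<nu> + u"
      and H: "real n * (\<integral>x. ln (r x) \<partial>density P r) \<le> - ln (prob (?A n))"
      by blast
    have "?I \<le> ereal (\<integral>x. ln (r x) \<partial>density P r)" by (rule E_I[OF r])
    also have "\<dots> \<le> ereal (- ln (prob (?A n)) / real n)"
      unfolding ereal_less_eq(3) using H n by (subst pos_le_divide_eq) (auto simp: mult.commute)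
    finally show "?I \<le> ereal (- ln (prob (?A n)) / real n)" .
  next
    \<comment> \<open>If the set is empty the infimum is \<open>\<infinity>\<close> and there is no
      such \<open>h\<close>; otherwise some admissible law has entropy below
      \<open>h\<close>.\<close>
    fix h assume "?I < ereal h"
    then obtain Q where Q: "Q \<in> E_set F \<mu> \<epsilon> U \<nu> u" and QI: "relative_entropy Q P < ereal h"
      by (auto simp: INF_less_iff)
    have "relative_entropy Q P < \<infinity>" using QI by (rule less_trans) simp
    from finite_entropy[OF Q this] obtain r where r: "r \<in> borel_measurable borel" "\<And>x. 0 \<le> r x" "Q = density P r"
      "integrable Q F" "integrable Q U" "integrable Q (\<lambda>x. ln (r x))"
      "\<mu> + \<epsilon> < (\<integral>x. F x \<partial>Q)" "(\<integral>x. U x \<partial>Q) < \<nu> + u" "relative_entropy Q P = ereal (\<integral>x. ln (r x) \<partial>Q)"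
      by blast
    have "prob_space Q" using Q by (simp add: E_set_def Sigma_set_def)
    with r QI show "\<forall>\<^sub>F n in sequentially. exp (- real n * h) \<le> prob (?A n)"
      by (intro deviation_lower_bound[of r]) auto
  qed simp
qed

end

text \<open>The generic variable of the moment hypotheses is \<open>X 0\<close>; the sums start at
  index 1, so it is an independent copy.\<close>

theorem theorem2p1:
  fixes M :: "'a measure" and X :: "nat \<Rightarrow> 'a \<Rightarrow> real" and P :: "real measure"
    and F U :: "real \<Rightarrow> real" and \<mu> \<nu> :: real and S T :: "nat \<Rightarrow> 'a \<Rightarrow> real"
  assumes "prob_space M"
    and "prob_space.indep_vars M (\<lambda>_. borel) X UNIV"
    and "\<And>i. distr M borel (X i) = P"
    and "F \<in> borel_measurable borel" and "U \<in> borel_measurable borel"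
    and "\<And>x. F x \<ge> 0"
    and "integrable M (\<lambda>\<omega>. F (X 0 \<omega>))" and "integrable M (\<lambda>\<omega>. U (X 0 \<omega>))"
    and "\<mu> = (\<integral>\<omega>. F (X 0 \<omega>) \<partial>M)" and "\<nu> = (\<integral>\<omega>. U (X 0 \<omega>) \<partial>M)"
    and "integrable M (\<lambda>\<omega>. (F (X 0 \<omega>))\<^sup>2)" and "integrable M (\<lambda>\<omega>. (U (X 0 \<omega>))\<^sup>2)"
    and "\<And>\<theta>::real. \<theta> > 0 \<Longrightarrow> (\<integral>\<^sup>+ \<omega>. ennreal (exp (\<theta> * F (X 0 \<omega>))) \<partial>M) = \<infinity>"
    and "\<And>\<beta>::real. \<beta> > 0 \<Longrightarrow> esssup P (\<lambda>x. ereal (F x - \<beta> * U x)) < \<infinity>"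
    and "\<And>n \<omega>. S n \<omega> = (\<Sum>i=1..n. F (X i \<omega>))"
    and "\<And>n \<omega>. T n \<omega> = (\<Sum>i=1..n. U (X i \<omega>))"
  shows "(\<forall>\<epsilon>>0.
           ((\<lambda>n. ereal (1 / real n) *
                 ext_ln (emeasure M {\<omega> \<in> space M. S n \<omega> - real n * \<mu> > real n * \<epsilon>}))
             \<longlonglongrightarrow> - (INF Q \<in> Sigma_set F \<mu> \<epsilon>. relative_entropy Q P)) \<and>
           - (INF Q \<in> Sigma_set F \<mu> \<epsilon>. relative_entropy Q P) = 0)
       \<and> (\<forall>\<epsilon>>0. \<forall>u>0.
           ((\<lambda>n. ereal (1 / real n) *
                 ext_ln (emeasure M {\<omega> \<in> space M. S n \<omega> - real n * \<mu> > real n * \<epsilon> \<and>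
                                                  T n \<omega> - real n * \<nu> < real n * u}))
             \<longlonglongrightarrow> - (INF Q \<in> E_set F \<mu> \<epsilon> U \<nu> u. relative_entropy Q P)) \<and>
           - (INF Q \<in> E_set F \<mu> \<epsilon> U \<nu> u. relative_entropy Q P) < 0)"
proof -
  interpret prob_space M by fact
  interpret iid_process M X P by unfold_locales fact+
  note [measurable] = assms(4,5)
  have F: "integrable P F" "integrable P (\<lambda>x. (F x)\<^sup>2)" and U: "integrable P U" "integrable P (\<lambda>x. (U x)\<^sup>2)"
    using assms(7,8,11,12) integrable_X[of F 0] integrable_X[of U 0]
      integrable_X[of "\<lambda>x. (F x)\<^sup>2" 0] integrable_X[of "\<lambda>x. (U x)\<^sup>2" 0] by auto
  have \<mu>: "\<mu> = (\<integral>x. F x \<partial>P)" and \<nu>: "\<nu> = (\<integral>x. U x \<partial>P)"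
    using assms(9,10) expectation_X[of F 0] expectation_X[of U 0] by auto
  have inf: "(\<integral>\<^sup>+ x. ennreal (exp (\<theta> * F x)) \<partial>P) = \<infinity>" if "0 < \<theta>" for \<theta>
    using assms(13)[OF that] nn_integral_X[of "\<lambda>x. ennreal (exp (\<theta> * F x))" 0] by simp
  have bdd: "\<exists>m. AE x in P. F x - \<beta> * U x \<le> m" if \<beta>: "0 < \<beta>" for \<beta>
  proof -
    \<comment> \<open>The essential supremum is an extended real, so a real number strictly above it
      is chosen.\<close>
    obtain m where m: "esssup P (\<lambda>x. ereal (F x - \<beta> * U x)) < ereal m"
      using ereal_dense2[OF assms(14)[OF \<beta>]] by blast
    have "AE x in P. F x - \<beta> * U x \<le> m"
      using esssup_AE[of "\<lambda>x. ereal (F x - \<beta> * U x)" P]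
    proof eventually_elim
      case (elim x)
      then have "ereal (F x - \<beta> * U x) < ereal m" using m by (rule order_le_less_trans)
      then show ?case by simp
    qed
    then show ?thesis by blast
  qed
  have ev_i: "emeasure M {\<omega> \<in> space M. S n \<omega> - real n * \<mu> > real n * \<epsilon>}
      = ennreal (prob {\<omega> \<in> space M. real n * (\<mu> + \<epsilon>) < (\<Sum>i=1..n. F (X i \<omega>))})" for n \<epsilon>
    unfolding emeasure_eq_measure assms(15) by (simp add: algebra_simps)
  have ev_ii: "emeasure M {\<omega> \<in> space M. S n \<omega> - real n * \<mu> > real n * \<epsilon> \<and> T n \<omega> - real n * \<nu> < real n * u}
      = ennreal (prob {\<omega> \<in> space M. real n * (\<mu> + \<epsilon>) < (\<Sum>i=1..n. F (X i \<omega>)) \<and>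
          (\<Sum>i=1..n. U (X i \<omega>)) < real n * (\<nu> + u)})" for n \<epsilon> u
    unfolding emeasure_eq_measure assms(15,16) by (simp add: algebra_simps)
  show ?thesis
    unfolding ev_i ev_ii
    using deviation_rate[OF assms(4,6) F(1) inf] joint_deviation_rate[OF assms(4,5,6) F(1) U(1) F(2) U(2) bdd]
    unfolding \<mu>[symmetric] \<nu>[symmetric] by (simp add: ereal_uminus_less_reorder)
qed

end
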